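(* Let $(\mathbf{u},\mathbf{v},\boldsymbol{\kappa})=(u_\lambda,v_\lambda,\kappa_\lambda)_{\lambda\in\Lambda}$ be a diagonal frame decomposition (DFD) of the bounded linear operator $\mathbf{K}:X\to Y$, with $\overline{\mathbf{u}}=(\overline{u}_\lambda)$ the dual frame of $\mathbf{u}$. Let $\varphi$ and the filter $(g_\alpha)_{\alpha>0}$ satisfy Assumptions A1, A2 and C (stated in the context), with $\gamma_1,\gamma_2$ the constants in Assumption A2. Let $E>0$, $A_v\in(0,|\mathbf{v}|_{\inf}^2)$, let $A_u$ be a lower frame bound of $\mathbf{u}$ and $B_v$ an upper frame bound of $\mathbf{v}$. Let $x^\ddagger\in\mathbf{M}_{\varphi,E}$ be the Moore–Penrose solution of $\mathbf{K}x=y$ and $\|y^\delta-y\|_Y\le\delta$. If $$\alpha(\delta):=\varphi^{-1}\circ\Theta^{-1}\left(A_v\delta^2/E^2\right),$$ then $$\|x^\delta_{\alpha(\delta)}-x^\ddagger\|_X\le\sqrt{A_u^{-1}A_v^{-1}}\left(\gamma_1\sqrt{B_v}+\gamma_2\sqrt{A_v}\right)E\sqrt{\Theta^{-1}\left(|\mathbf{v}|_{\inf}^2\delta^2/E^2\right)},$$ and consequently $$\Delta(\mathbf{M}_{\varphi,E},\delta,R_{\alpha(\delta)})\le\sqrt{A_u^{-1}A_v^{-1}}\left(\gamma_1\sqrt{B_v}+\gamma_2\sqrt{A_v}\right)E\sqrt{\Theta^{-1}\left(|\mathbf{v}|_{\inf}^2\delta^2/E^2\right)} .$$ Moreover: (i)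 If $\mathbf{u}$ is minimal (and $\inf_\lambda\kappa_\lambda=0$), then $R_{\alpha(\delta)}$ is sequential order optimal on $\mathbf{M}_{\varphi,E}$. (ii) For fixed $\beta\in(0,1)$, if $\mathbf{u}$ is minimal and $(0,\delta_0]\subset\bigcup_{\lambda\in\Lambda}D_{\lambda,\beta}$ for some $\delta_0>0$, then $R_{\alpha(\delta)}$ is uniform order optimal on $\mathbf{M}_{\varphi,E}$. Here $D_{\lambda,\beta}=[\delta^*_\lambda,\beta^{-1}\delta^*_\lambda]$ with $\delta^*_\lambda=|\mathbf{v}|_{\inf}^{-1}E\sqrt{\kappa_\lambda^2\varphi(\kappa_\lambda^2)}$.
   Context: $X,Y$ are Hilbert spaces, $\mathbf{K}:X\to Y$ is a bounded linear operator, $\Lambda$ is an at most countable index set. Frames. Let $H$ be a closed subspace of a Hilbert space $\mathbb{K}$. A family $\mathbf{w}=(w_\lambda)_{\lambda\in\Lambda}$ in $H$ is a frame over $H$ if there are $0<A_w,B_w<\infty$ (lower and upper frame bounds) with $A_w\|x\|^2\le\sum_\lambda|\langle x,w_\lambda\rangle|^2\le B_w\|x\|^2$ for all $x\in H$. It is minimal if $w_{\lambda_0}\notin\overline{\mathrm{span}}\{w_\lambda:\lambda\ne\lambda_0\}$ for every $\lambda_0$. For $x\in\mathbb{K}$ put $\|x\|_w=(\sum_\lambda|\langle x,w_\lambda\rangle|^2)^{1/2}$ and $|\mathbf{w}|_{\inf}=\inf\{\|x\|_w:x\in H,\|x\|=1\}$. The dual frame is $\overline{w}_\lambda=S^{-1}w_\lambda$,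 where $S:H\to H$, $Sx=\sum_\lambda\langle x,w_\lambda\rangle w_\lambda$. DFD. $(u_\lambda,v_\lambda,\kappa_\lambda)_{\lambda\in\Lambda}$ is a DFD of $\mathbf{K}$ if $(u_\lambda)$ is a frame over $(\ker\mathbf{K})^\perp$, $(v_\lambda)$ is a frame over $\overline{\mathrm{ran}\,\mathbf{K}}$, $\kappa_\lambda\in(0,\infty)$ and $\mathbf{K}^*v_\lambda=\kappa_\lambda u_\lambda$ for all $\lambda$. Index function. $a^*$ is an extended real number with $a^*>\sup_\lambda\kappa_\lambda^2$ if this supremum is finite, and $a^*=\infty$ otherwise. Assumption A1: $\varphi:(0,a^* )\to(0,\infty)$ is continuous, $\lim_{\mu\to0}\varphi(\mu)=0$, $\varphi$ is strictly increasing, and, with $\varphi(a^* ):=\lim_{\mu\to a^{*-}}\varphi(\mu)$, the function $\Theta:(0,\varphi(a^* )]\to(0,a^*\varphi(a^* )]$, $\Theta(\mu)=\mu\,\varphi^{-1}(\mu)$, is convex (endpoints omitted when infinite). Whenever $\Theta^{-1}(t)$ is written, $t$ is understood to lie in the range of $\Theta$. Filter. $g_\alpha:[0,a^* )\to\mathbb{R}$, $\alpha>0$. Assumption C: for every $\alpha>0$, $\sup_{\mu}|\sqrt{\mu}g_\alpha(\mu)|<\infty$; there is $C_g>0$ with $|\mu g_\alpha(\mu)|\le C_g$ for all $\alpha>0$, $\mu\in[0,a^* )$; $\lim_{\alpha\to0}\mu g_\alpha(\mu)=1$ for all $\mu\in(0,a^* )$. Assumption A2: there are constants $\gamma_1,\gamma_2>0$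 with $\sup_{0\le\mu<a^*}|\sqrt{\mu}g_\alpha(\mu)|\le\gamma_1/\sqrt{\alpha}$ and $\sup_{0\le\mu<a^*}|1-\mu g_\alpha(\mu)|\sqrt{\varphi(\mu)}\le\gamma_2\sqrt{\varphi(\alpha)}$ (the latter for $\alpha$ in the domain of $\varphi$, and with $\varphi(0):=0$). Regularization: $x^\delta_\alpha=R_\alpha y^\delta=\sum_{\lambda}\kappa_\lambda g_\alpha(\kappa_\lambda^2)\langle y^\delta,v_\lambda\rangle_Y\,\overline{u}_\lambda$. Source set: $\mathbf{M}_{\varphi,E}=\{x\in X:\sum_{\lambda}[\varphi(\kappa_\lambda^2)]^{-1}|\langle x,u_\lambda\rangle|^2\le E^2\}$. Worst-case error: for $\mathbf{R}:Y\to X$, $\Delta(\mathbf{M},\delta,\mathbf{R})=\sup\{\|\mathbf{R}y^\delta-x^\ddagger\|:x^\ddagger\in\mathbf{M},\ y^\delta\in Y,\ \|\mathbf{K}x^\ddagger-y^\delta\|\le\delta\}$, where $x^\ddagger$ ranges over Moore–Penrose (minimum-norm) solutions, i.e. $x^\ddagger\in\mathbf{M}\cap(\ker\mathbf{K})^\perp$. Infima $\inf_{\mathbf{R}}$ are over all maps $\mathbf{R}:Y\to X$. A method $R_{\alpha(\delta)}$ is sequential order optimal on $\mathbf{M}$ if there are a sequence $\delta_n\to0^+$ and $c>0$ independent of $n$ with $\Delta(\mathbf{M},\delta_n,R_{\alpha(\delta_n)})\le c\inf_{\mathbf{R}}\Delta(\mathbf{M},\delta_n,\mathbf{R})$ for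 all $n$; it is uniform order optimal if there are $\delta_1>0$ and $c>0$ independent of $\delta$ with $\Delta(\mathbf{M},\delta,R_{\alpha(\delta)})\le c\inf_{\mathbf{R}}\Delta(\mathbf{M},\delta,\mathbf{R})$ for every $\delta\in(0,\delta_1)$. *)

theory Defs
  imports "HOL-Analysis.Analysis"
begin

section \<open>Hilbert spaces over the real or the complex numbers\<close>

text \<open>
  The scalars are a normed field with a conjugation satisfying \<open>z * conj z = \<bar>z\<bar>\<^sup>2\<close>.  By Gelfand-Mazur
  such a field is isomorphic to the reals or to the complex numbers; both are instances below, so
  that quantifying over this class treats real and complex Hilbert spaces at the same time.
\<close>

class rc_field = real_normed_field +
  fixes sconj :: "'a \<Rightarrow> 'a"
  assumes sconj_add: "sconj (a + b) = sconj a + sconj b"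
    and sconj_mult: "sconj (a * b) = sconj a * sconj b"
    and sconj_sconj: "sconj (sconj a) = a"
    and mult_sconj: "a * sconj a = (norm a)\<^sup>2 *\<^sub>R 1"

instantiation real :: rc_field
begin
definition sconj_real :: "real \<Rightarrow> real" where "sconj_real a = a"
instance by standard (simp_all add: sconj_real_def power2_eq_square)
end

instantiation complex :: rc_field
begin
definition sconj_complex :: "complex \<Rightarrow> complex" where "sconj_complex a = cnj a"
instance
proof
  fix a b :: complex
  show "a * sconj a = (norm a)\<^sup>2 *\<^sub>R 1"
    by (simp add: sconj_complex_def complex_norm_square scaleR_conv_of_real del: of_real_power)
qed (simp_all add: sconj_complex_def)
end

text \<open>
  The type provides completeness and the norm topology (hence closures and infinite sums).  The inner
  product is linear in its first argument and induces the norm of the type.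
\<close>

locale hilbert_space = vector_space smul
  for smul :: "'k::rc_field \<Rightarrow> 'a::banach \<Rightarrow> 'a" +
  fixes ip :: "'a \<Rightarrow> 'a \<Rightarrow> 'k"
  assumes smul_of_real: "smul (of_real r) x = r *\<^sub>R x"
    and ip_add_left: "ip (x + y) z = ip x z + ip y z"
    and ip_smul_left: "ip (smul a x) y = a * ip x y"
    and ip_commute: "ip y x = sconj (ip x y)"
    and ip_self: "ip x x = of_real ((norm x)\<^sup>2)"

lemma hilbert_space_real_inner:
  "hilbert_space (scaleR :: real \<Rightarrow> 'a::{real_inner, banach} \<Rightarrow> 'a) inner"
  by unfold_locales
    (simp_all add: sconj_real_def inner_add_left inner_commute power2_norm_eq_inner algebra_simps)

lemma hilbert_space_complex: "hilbert_space (*) (\<lambda>x y :: complex. x * cnj y)"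
proof unfold_locales
  fix x :: complex
  show "x * cnj x = of_real ((norm x)\<^sup>2)"
    by (rule complex_norm_square [symmetric])
qed (simp_all add: sconj_complex_def algebra_simps scaleR_conv_of_real)

definition orth_compl :: "('a \<Rightarrow> 'a \<Rightarrow> 'k::zero) \<Rightarrow> 'a set \<Rightarrow> 'a set" where
  "orth_compl ip S = {x. \<forall>z\<in>S. ip x z = 0}"

definition ker :: "('a \<Rightarrow> 'b::zero) \<Rightarrow> 'a set" where
  "ker K = {x. K x = 0}"

definition adjoint_op ::
  "('x \<Rightarrow> 'x \<Rightarrow> 'k) \<Rightarrow> ('y \<Rightarrow> 'y \<Rightarrow> 'k) \<Rightarrow> ('x \<Rightarrow> 'y) \<Rightarrow> 'y \<Rightarrow> 'x" where
  "adjoint_op ipX ipY K y = (THE z. \<forall>x. ipY (K x) y = ipX x z)"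

text \<open>The Moore-Penrose solution of \<open>K x = y\<close>: the least-squares solution of minimum norm.\<close>

definition least_squares_solution ::
  "('x \<Rightarrow> 'y::real_normed_vector) \<Rightarrow> 'y \<Rightarrow> 'x \<Rightarrow> bool" where
  "least_squares_solution K y x \<longleftrightarrow> (\<forall>z. norm (K x - y) \<le> norm (K z - y))"

definition moore_penrose_solution ::
  "('x::real_normed_vector \<Rightarrow> 'y::real_normed_vector) \<Rightarrow> 'y \<Rightarrow> 'x \<Rightarrow> bool" where
  "moore_penrose_solution K y x \<longleftrightarrow> least_squares_solution K y x \<and>
     (\<forall>z. least_squares_solution K y z \<longrightarrow> norm x \<le> norm z)"


section \<open>Frames and diagonal frame decompositions\<close>

definition lower_frame_bound ::
  "('a::real_normed_vector \<Rightarrow> 'a \<Rightarrow> 'k::real_normed_field) \<Rightarrow> 'i set \<Rightarrow> ('i \<Rightarrow> 'a) \<Rightarrow> 'a set \<Rightarrow> real \<Rightarrow> bool"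
  where "lower_frame_bound ip \<Lambda> w H A \<longleftrightarrow>
    0 < A \<and> (\<forall>x\<in>H. A * (norm x)\<^sup>2 \<le> (\<Sum>\<^sub>\<infinity>i\<in>\<Lambda>. (norm (ip x (w i)))\<^sup>2))"

text \<open>Summability is part of the upper bound, because \<open>infsum\<close> is 0 on families that are not summable.\<close>

definition upper_frame_bound ::
  "('a::real_normed_vector \<Rightarrow> 'a \<Rightarrow> 'k::real_normed_field) \<Rightarrow> 'i set \<Rightarrow> ('i \<Rightarrow> 'a) \<Rightarrow> 'a set \<Rightarrow> real \<Rightarrow> bool"
  where "upper_frame_bound ip \<Lambda> w H B \<longleftrightarrow>
    0 < B \<and> (\<forall>x\<in>H. (\<lambda>i. (norm (ip x (w i)))\<^sup>2) summable_on \<Lambda> \<and>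
                   (\<Sum>\<^sub>\<infinity>i\<in>\<Lambda>. (norm (ip x (w i)))\<^sup>2) \<le> B * (norm x)\<^sup>2)"

definition is_frame ::
  "('a::real_normed_vector \<Rightarrow> 'a \<Rightarrow> 'k::real_normed_field) \<Rightarrow> 'i set \<Rightarrow> ('i \<Rightarrow> 'a) \<Rightarrow> 'a set \<Rightarrow> bool"
  where "is_frame ip \<Lambda> w H \<longleftrightarrow> (\<forall>i\<in>\<Lambda>. w i \<in> H) \<and>
    (\<exists>A. lower_frame_bound ip \<Lambda> w H A) \<and> (\<exists>B. upper_frame_bound ip \<Lambda> w H B)"

definition minimal_family ::
  "('k::field \<Rightarrow> 'a::real_normed_vector \<Rightarrow> 'a) \<Rightarrow> 'i set \<Rightarrow> ('i \<Rightarrow> 'a) \<Rightarrow> bool" where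
  "minimal_family smul \<Lambda> w \<longleftrightarrow>
     (\<forall>i0\<in>\<Lambda>. w i0 \<notin> closure (module.span smul (w ` (\<Lambda> - {i0}))))"

definition frame_norm ::
  "('a \<Rightarrow> 'a \<Rightarrow> 'k::real_normed_field) \<Rightarrow> 'i set \<Rightarrow> ('i \<Rightarrow> 'a) \<Rightarrow> 'a \<Rightarrow> real" where
  "frame_norm ip \<Lambda> w x = sqrt (\<Sum>\<^sub>\<infinity>i\<in>\<Lambda>. (norm (ip x (w i)))\<^sup>2)"

text \<open>If \<open>H = {0}\<close>, the infimum is over the empty set and this real number has no meaning.\<close>

definition frame_inf ::
  "('a::real_normed_vector \<Rightarrow> 'a \<Rightarrow> 'k::real_normed_field) \<Rightarrow> 'i set \<Rightarrow> ('i \<Rightarrow> 'a) \<Rightarrow> 'a set \<Rightarrow> real"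
  where "frame_inf ip \<Lambda> w H = Inf {frame_norm ip \<Lambda> w x | x. x \<in> H \<and> norm x = 1}"

definition frame_operator ::
  "('k \<Rightarrow> 'a::real_normed_vector \<Rightarrow> 'a) \<Rightarrow> ('a \<Rightarrow> 'a \<Rightarrow> 'k) \<Rightarrow> 'i set \<Rightarrow> ('i \<Rightarrow> 'a) \<Rightarrow> 'a \<Rightarrow> 'a" where
  "frame_operator smul ip \<Lambda> w x = (\<Sum>\<^sub>\<infinity>i\<in>\<Lambda>. smul (ip x (w i)) (w i))"

definition dual_frame ::
  "('k \<Rightarrow> 'a::real_normed_vector \<Rightarrow> 'a) \<Rightarrow> ('a \<Rightarrow> 'a \<Rightarrow> 'k) \<Rightarrow> 'i set \<Rightarrow> ('i \<Rightarrow> 'a) \<Rightarrow> 'a set \<Rightarrow> 'i \<Rightarrow> 'a"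
  where "dual_frame smul ip \<Lambda> w H i = the_inv_into H (frame_operator smul ip \<Lambda> w) (w i)"

definition is_DFD ::
  "('x::real_normed_vector \<Rightarrow> 'x \<Rightarrow> 'k::real_normed_field) \<Rightarrow>
   ('y::real_normed_vector \<Rightarrow> 'y \<Rightarrow> 'k) \<Rightarrow> ('x \<Rightarrow> 'y) \<Rightarrow>
   'i set \<Rightarrow> ('i \<Rightarrow> 'x) \<Rightarrow> ('i \<Rightarrow> 'y) \<Rightarrow> ('i \<Rightarrow> real) \<Rightarrow> bool" where
  "is_DFD ipX ipY K \<Lambda> u v \<kappa> \<longleftrightarrow>
     is_frame ipX \<Lambda> u (orth_compl ipX (ker K)) \<and>
     is_frame ipY \<Lambda> v (closure (range K)) \<and>
     (\<forall>i\<in>\<Lambda>. 0 < \<kappa> i \<and> adjoint_op ipX ipY K (v i) = \<kappa> i *\<^sub>R u i)"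


section \<open>Index functions and filters\<close>

text \<open>
  Functions on \<open>(0, a)\<close> and \<open>[0, a)\<close>, \<open>a\<close> an extended real, are represented by total real functions;
  all conditions below only concern their values on these intervals.
\<close>

definition endpoint_cond :: "'i set \<Rightarrow> ('i \<Rightarrow> real) \<Rightarrow> ereal \<Rightarrow> bool" where
  "endpoint_cond \<Lambda> \<kappa> a \<longleftrightarrow>
     (if (SUP i\<in>\<Lambda>. ereal ((\<kappa> i)\<^sup>2)) < \<infinity>
      then (SUP i\<in>\<Lambda>. ereal ((\<kappa> i)\<^sup>2)) < a else a = \<infinity>)"

definition open_dom :: "ereal \<Rightarrow> real set" where
  "open_dom a = {\<mu>. 0 < \<mu> \<and> ereal \<mu> < a}"

definition half_open_dom :: "ereal \<Rightarrow> real set" where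
  "half_open_dom a = {\<mu>. 0 \<le> \<mu> \<and> ereal \<mu> < a}"

definition phi_end :: "ereal \<Rightarrow> (real \<Rightarrow> real) \<Rightarrow> ereal" where
  "phi_end a \<phi> = Lim (at_left a) (\<lambda>\<mu>. ereal (\<phi> (real_of_ereal \<mu>)))"

text \<open>
  The inverse of \<open>\<phi>\<close>, extended by \<open>\<phi>(a) \<mapsto> a\<close>.  The extension is only used when \<open>a\<close> and \<open>\<phi>(a)\<close> are both
  finite: otherwise \<open>\<phi>(a)\<close> is not in the domain of \<open>\<Theta>\<close>.
\<close>

definition phi_inv :: "ereal \<Rightarrow> (real \<Rightarrow> real) \<Rightarrow> real \<Rightarrow> real" where
  "phi_inv a \<phi> s =
     (if ereal s = phi_end a \<phi> then real_of_ereal a else the_inv_into (open_dom a) \<phi> s)"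

definition Theta_dom :: "ereal \<Rightarrow> (real \<Rightarrow> real) \<Rightarrow> real set" where
  "Theta_dom a \<phi> =
     {s. 0 < s \<and> (ereal s < phi_end a \<phi> \<or> ereal s = phi_end a \<phi> \<and> a < \<infinity>)}"

definition Theta :: "ereal \<Rightarrow> (real \<Rightarrow> real) \<Rightarrow> real \<Rightarrow> real" where
  "Theta a \<phi> s = s * phi_inv a \<phi> s"

definition Theta_inv :: "ereal \<Rightarrow> (real \<Rightarrow> real) \<Rightarrow> real \<Rightarrow> real" where
  "Theta_inv a \<phi> = the_inv_into (Theta_dom a \<phi>) (Theta a \<phi>)"

definition index_function :: "ereal \<Rightarrow> (real \<Rightarrow> real) \<Rightarrow> bool" where
  "index_function a \<phi> \<longleftrightarrow> 0 < a \<and>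
     (\<forall>\<mu>\<in>open_dom a. 0 < \<phi> \<mu>) \<and> continuous_on (open_dom a) \<phi> \<and>
     (\<phi> \<longlongrightarrow> 0) (at_right 0) \<and> strict_mono_on (open_dom a) \<phi> \<and>
     convex_on (Theta_dom a \<phi>) (Theta a \<phi>)"

definition regularizing_filter :: "ereal \<Rightarrow> (real \<Rightarrow> real \<Rightarrow> real) \<Rightarrow> bool" where
  "regularizing_filter a g \<longleftrightarrow>
     (\<forall>\<alpha>>0. (SUP \<mu>\<in>half_open_dom a. ereal \<bar>sqrt \<mu> * g \<alpha> \<mu>\<bar>) < \<infinity>) \<and>
     (\<exists>C>0. \<forall>\<alpha>>0. \<forall>\<mu>\<in>half_open_dom a. \<bar>\<mu> * g \<alpha> \<mu>\<bar> \<le> C) \<and>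
     (\<forall>\<mu>\<in>open_dom a. ((\<lambda>\<alpha>. \<mu> * g \<alpha> \<mu>) \<longlongrightarrow> 1) (at_right 0))"

definition filter_qualification ::
  "ereal \<Rightarrow> (real \<Rightarrow> real) \<Rightarrow> (real \<Rightarrow> real \<Rightarrow> real) \<Rightarrow> real \<Rightarrow> real \<Rightarrow> bool" where
  "filter_qualification a \<phi> g \<gamma>1 \<gamma>2 \<longleftrightarrow> 0 < \<gamma>1 \<and> 0 < \<gamma>2 \<and>
     (\<forall>\<alpha>>0. (SUP \<mu>\<in>half_open_dom a. ereal \<bar>sqrt \<mu> * g \<alpha> \<mu>\<bar>) \<le> ereal (\<gamma>1 / sqrt \<alpha>)) \<and>
     (\<forall>\<alpha>\<in>open_dom a.
        (SUP \<mu>\<in>half_open_dom a.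
           ereal (\<bar>1 - \<mu> * g \<alpha> \<mu>\<bar> * sqrt (if \<mu> = 0 then 0 else \<phi> \<mu>))) \<le> ereal (\<gamma>2 * sqrt (\<phi> \<alpha>)))"


section \<open>The regularization method and its worst-case error\<close>

definition filtered_DFD ::
  "('k::real_normed_field \<Rightarrow> 'x::real_normed_vector \<Rightarrow> 'x) \<Rightarrow> ('x \<Rightarrow> 'x \<Rightarrow> 'k) \<Rightarrow>
   ('y \<Rightarrow> 'y \<Rightarrow> 'k) \<Rightarrow> ('x \<Rightarrow> 'y::zero) \<Rightarrow> 'i set \<Rightarrow> ('i \<Rightarrow> 'x) \<Rightarrow> ('i \<Rightarrow> 'y) \<Rightarrow> ('i \<Rightarrow> real) \<Rightarrow>
   (real \<Rightarrow> real \<Rightarrow> real) \<Rightarrow> real \<Rightarrow> 'y \<Rightarrow> 'x" where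
  "filtered_DFD scX ipX ipY K \<Lambda> u v \<kappa> g \<alpha> y =
     (\<Sum>\<^sub>\<infinity>i\<in>\<Lambda>. scX (of_real (\<kappa> i * g \<alpha> ((\<kappa> i)\<^sup>2)) * ipY y (v i))
                 (dual_frame scX ipX \<Lambda> u (orth_compl ipX (ker K)) i))"

definition source_set ::
  "('x \<Rightarrow> 'x \<Rightarrow> 'k::real_normed_field) \<Rightarrow> 'i set \<Rightarrow> ('i \<Rightarrow> 'x) \<Rightarrow> ('i \<Rightarrow> real) \<Rightarrow> (real \<Rightarrow> real) \<Rightarrow>
   real \<Rightarrow> 'x set" where
  "source_set ip \<Lambda> u \<kappa> \<phi> E =
     {x. (\<lambda>i. inverse (\<phi> ((\<kappa> i)\<^sup>2)) * (norm (ip x (u i)))\<^sup>2) summable_on \<Lambda> \<and>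
         (\<Sum>\<^sub>\<infinity>i\<in>\<Lambda>. inverse (\<phi> ((\<kappa> i)\<^sup>2)) * (norm (ip x (u i)))\<^sup>2) \<le> E\<^sup>2}"

definition parameter_choice :: "ereal \<Rightarrow> (real \<Rightarrow> real) \<Rightarrow> real \<Rightarrow> real \<Rightarrow> real \<Rightarrow> real" where
  "parameter_choice a \<phi> A E \<delta> = phi_inv a \<phi> (Theta_inv a \<phi> (A * \<delta>\<^sup>2 / E\<^sup>2))"

definition worst_case_error ::
  "('x::real_normed_vector \<Rightarrow> 'x \<Rightarrow> 'k::zero) \<Rightarrow> ('x \<Rightarrow> 'y::real_normed_vector) \<Rightarrow> 'x set \<Rightarrow> real \<Rightarrow>
   ('y \<Rightarrow> 'x) \<Rightarrow> ennreal" where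
  "worst_case_error ip K M \<delta> R =
     (SUP (x, yd) \<in> {(x, yd). x \<in> M \<inter> orth_compl ip (ker K) \<and> norm (K x - yd) \<le> \<delta>}.
        ennreal (norm (R yd - x)))"

text \<open>In the next two definitions, \<open>R \<delta>\<close> is the reconstruction map used at noise level \<open>\<delta>\<close>.\<close>

definition sequential_order_optimal ::
  "('x::real_normed_vector \<Rightarrow> 'x \<Rightarrow> 'k::zero) \<Rightarrow> ('x \<Rightarrow> 'y::real_normed_vector) \<Rightarrow> 'x set \<Rightarrow>
   (real \<Rightarrow> 'y \<Rightarrow> 'x) \<Rightarrow> bool" where
  "sequential_order_optimal ip K M R \<longleftrightarrow>
     (\<exists>\<delta> :: nat \<Rightarrow> real. \<exists>c>0. (\<forall>n. 0 < \<delta> n) \<and> \<delta> \<longlonglongrightarrow> 0 \<and>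
        (\<forall>n. worst_case_error ip K M (\<delta> n) (R (\<delta> n))
               \<le> ennreal c * (INF R'. worst_case_error ip K M (\<delta> n) R')))"

definition uniform_order_optimal ::
  "('x::real_normed_vector \<Rightarrow> 'x \<Rightarrow> 'k::zero) \<Rightarrow> ('x \<Rightarrow> 'y::real_normed_vector) \<Rightarrow> 'x set \<Rightarrow>
   (real \<Rightarrow> 'y \<Rightarrow> 'x) \<Rightarrow> bool" where
  "uniform_order_optimal ip K M R \<longleftrightarrow>
     (\<exists>\<delta>1>0. \<exists>c>0. \<forall>\<delta>. 0 < \<delta> \<and> \<delta> < \<delta>1 \<longrightarrow>
        worst_case_error ip K M \<delta> (R \<delta>)
          \<le> ennreal c * (INF R'. worst_case_error ip K M \<delta> R'))"

definition delta_star :: "real \<Rightarrow> real \<Rightarrow> (real \<Rightarrow> real) \<Rightarrow> real \<Rightarrow> real" where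
  "delta_star vinf E \<phi> k = inverse vinf * E * sqrt (k\<^sup>2 * \<phi> (k\<^sup>2))"

end

theory Submission
  imports Defs
begin

text \<open>
  Because \<open>K\<^sup>* v\<^sub>i = \<kappa>\<^sub>i u\<^sub>i\<close>, the analysis coefficients of the data are
  \<open>\<langle>K x, v\<^sub>i\<rangle> = \<kappa>\<^sub>i \<langle>x, u\<^sub>i\<rangle>\<close>, so that the method acts diagonally.  For \<open>x\<close> orthogonal to the kernel,
  the reconstruction formula \<open>x = \<Sum> \<langle>x, u\<^sub>i\<rangle> dual\<^sub>i\<close> shows that the error is the dual synthesis of
  \<open>\<kappa>\<^sub>i g\<^sub>\<alpha>(\<kappa>\<^sub>i\<^sup>2) \<langle>d, v\<^sub>i\<rangle> - (1 - \<kappa>\<^sub>i\<^sup>2 g\<^sub>\<alpha>(\<kappa>\<^sub>i\<^sup>2)) \<langle>x, u\<^sub>i\<rangle>\<close>, where \<open>d\<close> is the noise.  Dual synthesis has norm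
  at most \<open>A\<^sub>u\<^sup>-\<^sup>1\<^sup>/\<^sup>2\<close>, the noise part has square sum at most \<open>\<gamma>1\<^sup>2 B\<^sub>v \<delta>\<^sup>2 / \<alpha>\<close>, and the approximation
  part at most \<open>\<gamma>2\<^sup>2 \<phi>(\<alpha>) E\<^sup>2\<close> by the source condition (lemma \<open>error_bound\<close>).  The parameter choice
  means \<open>\<alpha> \<phi>(\<alpha>) = A\<^sub>v \<delta>\<^sup>2 / E\<^sup>2\<close>, which turns both parts into multiples of \<open>E \<surd>\<phi>(\<alpha>)\<close>; as \<open>\<phi>(\<alpha>)\<close> is
  \<open>\<Theta>\<^sup>-\<^sup>1(A\<^sub>v \<delta>\<^sup>2 / E\<^sup>2)\<close>, monotonicity of \<open>\<Theta>\<^sup>-\<^sup>1\<close> gives the rate.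

  For optimality, any reconstruction errs by at least \<open>\<parallel>x\<parallel>\<close> if \<open>x\<close> and \<open>-x\<close> are admissible and
  \<open>\<parallel>K x\<parallel> \<le> \<delta>\<close>, since the data \<open>0\<close> cannot tell them apart.  A minimal frame is biorthogonal to its
  dual frame (lemma \<open>minimal_imp_biorthogonal\<close>), so that \<open>x = E \<surd>\<phi>(\<kappa>\<^sub>j\<^sup>2) dual\<^sub>j\<close> lies in the source set
  and satisfies \<open>\<parallel>K x\<parallel> \<le> \<delta>\<^sup>*\<^sub>j\<close> and \<open>\<parallel>x\<parallel> \<ge> E \<surd>\<phi>(\<kappa>\<^sub>j\<^sup>2) / \<surd>B\<^sub>u\<close>.  At \<open>\<delta> = \<delta>\<^sup>*\<^sub>j\<close> this is the upper bound up to a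
  constant, because \<open>|v|\<^sub>i\<^sub>n\<^sub>f\<^sup>2 \<delta>\<^sup>2 / E\<^sup>2 = \<Theta>(\<phi>(\<kappa>\<^sub>j\<^sup>2))\<close>; for \<open>\<delta>\<close> up to \<open>\<delta>\<^sup>*\<^sub>j / \<beta>\<close> the upper bound grows by a
  factor of at most \<open>1 / \<beta>\<close> (lemma \<open>order_optimal_at\<close>).

  The Hilbert space facts behind this are Riesz representation, by which the adjoint exists, and the
  bijectivity of the frame operator, which follows from the Banach fixed point theorem.
\<close>

section \<open>Scalars and inner products\<close>

lemma sconj_0 [simp]: "sconj (0 :: 'k::rc_field) = 0"
  using sconj_add [of "0 :: 'k" 0] by simp

lemma sconj_minus: "sconj (- a) = - sconj (a :: 'k::rc_field)"
  using sconj_add [of a "- a"] by (simp add: eq_neg_iff_add_eq_0 add.commute)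

lemma mult_sconj_of_real: "a * sconj a = of_real ((norm a)\<^sup>2)" for a :: "'k::rc_field"
  by (simp add: mult_sconj scaleR_conv_of_real)

lemma sconj_of_real [simp]: "sconj (of_real r :: 'k::rc_field) = of_real r"
proof (cases "r = 0")
  case False
  have "of_real r * sconj (of_real r :: 'k) = of_real r * of_real r"
    unfolding mult_sconj_of_real by (simp add: power2_eq_square flip: of_real_mult)
  then show ?thesis using False by simp
qed simp

lemma norm_sconj [simp]: "norm (sconj a) = norm (a :: 'k::rc_field)"
proof (cases "a = 0")
  case False
  have "norm (a * sconj a) = (norm a)\<^sup>2"
    by (simp add: mult_sconj)
  then show ?thesis using False by (simp add: norm_mult power2_eq_square)
qed simp

context hilbert_space
begin

lemma ip_zero_left [simp]: "ip 0 z = 0"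
  using ip_add_left [of 0 0 z] by simp

lemma ip_zero_right [simp]: "ip z 0 = 0"
  using ip_commute [of z 0] by simp

lemma ip_minus_left: "ip (- x) z = - ip x z"
  using ip_add_left [of x "- x" z] by (simp add: eq_neg_iff_add_eq_0 add.commute)

lemma ip_diff_left: "ip (x - y) z = ip x z - ip y z"
  using ip_add_left [of x "- y" z] by (simp add: ip_minus_left)

lemma ip_add_right: "ip x (y + z) = ip x y + ip x z"
  by (subst (1 2 3) ip_commute) (simp add: ip_add_left sconj_add)

lemma ip_minus_right: "ip x (- y) = - ip x y"
  by (subst (1 2) ip_commute) (simp add: ip_minus_left sconj_minus)

lemma ip_diff_right: "ip x (y - z) = ip x y - ip x z"
  using ip_add_right [of x y "- z"] by (simp add: ip_minus_right)

lemma ip_smul_right: "ip x (smul a y) = sconj a * ip x y"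
  by (subst (1 2) ip_commute) (simp add: ip_smul_left sconj_mult)

lemma ip_sum_left: "ip (\<Sum>i\<in>F. f i) z = (\<Sum>i\<in>F. ip (f i) z)"
  by (induction F rule: infinite_finite_induct) (simp_all add: ip_add_left)

lemma ip_scaleR_left: "ip (r *\<^sub>R x) y = of_real r * ip x y"
  by (simp add: ip_smul_left flip: smul_of_real)

lemma ip_scaleR_right: "ip x (r *\<^sub>R y) = of_real r * ip x y"
  by (simp add: ip_smul_right flip: smul_of_real)

lemma norm_ip_commute: "norm (ip x y) = norm (ip y x)"
  by (subst ip_commute) simp

lemma norm_smul: "norm (smul a x) = norm a * norm x"
proof -
  have "of_real ((norm (smul a x))\<^sup>2) = (a * sconj a) * ip x x"
    unfolding ip_self [symmetric] by (simp add: ip_smul_left ip_smul_right)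
  also have "\<dots> = of_real ((norm a * norm x)\<^sup>2)"
    unfolding mult_sconj_of_real ip_self by (simp add: power_mult_distrib)
  finally have "(norm (smul a x))\<^sup>2 = (norm a * norm x)\<^sup>2"
    by (simp only: of_real_eq_iff)
  then show ?thesis by (simp add: power2_eq_iff_nonneg)
qed

text \<open>
  Subtracting the component of \<open>r\<close> along \<open>w\<close>.  Both the Cauchy-Schwarz inequality and the
  orthogonality of minimal vectors are read off from this identity.
\<close>

lemma norm_minus_component:
  assumes "w \<noteq> 0"
  shows "(norm (r - smul (of_real (inverse ((norm w)\<^sup>2)) * ip r w) w))\<^sup>2
           = (norm r)\<^sup>2 - (norm (ip r w))\<^sup>2 / (norm w)\<^sup>2"
proof -
  define N where "N = (norm w)\<^sup>2"
  define b where "b = ip r w"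
  define c where "c = of_real (inverse N) * b"
  have N: "N \<noteq> 0" using assms by (simp add: N_def)
  have b': "ip w r = sconj b" using ip_commute [of w r] by (simp add: b_def)
  have c': "sconj c = of_real (inverse N) * sconj b" by (simp only: c_def sconj_mult sconj_of_real)
  have bb: "b * sconj b = of_real ((norm b)\<^sup>2)" by (rule mult_sconj_of_real)
  have "of_real ((norm (r - smul c w))\<^sup>2)
      = ip r r - sconj c * b - (c * ip w r - c * (sconj c * ip w w))"
    unfolding ip_self [symmetric]
    by (simp add: ip_diff_left ip_diff_right ip_smul_left ip_smul_right b_def right_diff_distrib)
  also have "\<dots> = ip r r - of_real (inverse N) * (b * sconj b)
      - (of_real (inverse N) * (b * sconj b)
         - of_real (inverse N) * of_real (inverse N) * (b * sconj b) * of_real N)"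
    unfolding b' c' ip_self [of w] N_def [symmetric] by (simp add: c_def algebra_simps)
  also have "\<dots> = of_real ((norm r)\<^sup>2 - (norm b)\<^sup>2 / N)"
    unfolding bb ip_self using N by (simp add: field_simps)
  finally show ?thesis
    unfolding of_real_eq_iff by (simp only: N_def b_def c_def)
qed

lemma norm_ip_le: "norm (ip x y) \<le> norm x * norm y"
proof (cases "y = 0")
  case False
  then have N: "0 < (norm y)\<^sup>2" by simp
  have "0 \<le> (norm x)\<^sup>2 - (norm (ip x y))\<^sup>2 / (norm y)\<^sup>2"
    by (simp only: norm_minus_component [OF False, of x, symmetric] zero_le_power2)
  then have "(norm (ip x y))\<^sup>2 \<le> (norm x * norm y)\<^sup>2"
    using N by (simp add: field_simps power_mult_distrib)
  then show ?thesis by (rule power2_le_imp_le) simp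
qed simp

lemma minimal_imp_orthogonal:
  assumes "\<And>c. norm r \<le> norm (r + smul c w)"
  shows "ip r w = 0"
proof (cases "w = 0")
  case False
  have "(norm r)\<^sup>2 \<le> (norm (r - smul (of_real (inverse ((norm w)\<^sup>2)) * ip r w) w))\<^sup>2"
    using assms [of "- (of_real (inverse ((norm w)\<^sup>2)) * ip r w)"] by simp
  then show ?thesis
    unfolding norm_minus_component [OF False] using False by (simp add: divide_le_0_iff)
qed simp

lemma bounded_linear_ip_left: "bounded_linear (\<lambda>x. ip x z)"
proof (rule bounded_linear_intro [where K = "norm z"])
  show "ip (r *\<^sub>R x) z = r *\<^sub>R ip x z" for r x
    by (simp add: ip_scaleR_left scaleR_conv_of_real)
qed (auto simp: ip_add_left norm_ip_le)

lemma bounded_linear_smul_right: "bounded_linear (smul a)"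
proof (rule bounded_linear_intro [where K = "norm a"])
  show "smul a (r *\<^sub>R x) = r *\<^sub>R smul a x" for r x
    by (simp add: mult.commute flip: smul_of_real)
qed (auto simp: scale_right_distrib norm_smul)

lemma parallelogram:
  fixes x y :: 'a
  shows "(norm (x - y))\<^sup>2 + (norm (x + y))\<^sup>2 = 2 * (norm x)\<^sup>2 + 2 * (norm y)\<^sup>2"
proof -
  have "ip (x - y) (x - y) + ip (x + y) (x + y) = 2 * ip x x + 2 * ip y y"
    by (simp add: ip_diff_left ip_diff_right ip_add_left ip_add_right)
  then have "(of_real ((norm (x - y))\<^sup>2 + (norm (x + y))\<^sup>2) :: 'k)
      = of_real (2 * (norm x)\<^sup>2 + 2 * (norm y)\<^sup>2)"
    unfolding ip_self by simp
  then show ?thesis unfolding of_real_eq_iff .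
qed

section \<open>Riesz representation and adjoints\<close>

text \<open>
  By the parallelogram law, vectors of almost minimal norm on the affine hyperplane \<open>f = 1\<close> are
  close to each other, so that a minimizing sequence converges.
\<close>

lemma exists_minimal_norm:
  fixes f :: "'a \<Rightarrow> 'k"
  assumes f: "bounded_linear f" and x1: "f x1 = 1"
  shows "\<exists>z. f z = 1 \<and> (\<forall>x. f x = 1 \<longrightarrow> norm z \<le> norm x)"
proof -
  interpret f: bounded_linear f by (rule f)
  define m where "m = Inf {(norm x)\<^sup>2 | x. f x = 1}"
  have bdd: "bdd_below {(norm x)\<^sup>2 | x. f x = 1}"
    by (rule bdd_belowI [of _ 0]) auto
  have m_le: "m \<le> (norm x)\<^sup>2" if "f x = 1" for x
    unfolding m_def by (rule cInf_lower [OF _ bdd]) (use that in auto)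
  have "\<exists>x. f x = 1 \<and> (norm x)\<^sup>2 < m + 1 / real (Suc n)" for n
  proof -
    have "\<exists>q\<in>{(norm x)\<^sup>2 | x. f x = 1}. q < m + 1 / real (Suc n)"
      unfolding m_def by (rule cInf_lessD) (use x1 in auto)
    then show ?thesis by auto
  qed
  then obtain X where X: "\<And>n. f (X n) = 1" "\<And>n. (norm (X n))\<^sup>2 < m + 1 / real (Suc n)"
    by metis
  have close: "(norm (X k - X l))\<^sup>2 \<le> 2 / real (Suc k) + 2 / real (Suc l)" for k l
  proof -
    have "f ((1/2) *\<^sub>R (X k + X l)) = 1"
      by (simp only: f.scaleR f.add X) (simp add: scaleR_conv_of_real)
    then have "m \<le> (norm ((1/2) *\<^sub>R (X k + X l)))\<^sup>2" by (rule m_le)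
    then have "4 * m \<le> (norm (X k + X l))\<^sup>2" by (simp add: power_divide)
    then show ?thesis
      using parallelogram [of "X k" "X l"] X(2) [of k] X(2) [of l] by simp
  qed
  have "Cauchy X"
  proof (rule metric_CauchyI)
    fix e :: real assume e: "0 < e"
    obtain N where N: "4 / e\<^sup>2 < real N" using reals_Archimedean2 by blast
    have "dist (X k) (X l) < e" if "N \<le> k" "N \<le> l" for k l
    proof -
      have N1: "4 / e\<^sup>2 < real (Suc N)" using N by simp
      have "2 / real (Suc k) \<le> 2 / real (Suc N)" "2 / real (Suc l) \<le> 2 / real (Suc N)"
        using that by (auto intro!: divide_left_mono)
      with close [of k l] have "(norm (X k - X l))\<^sup>2 \<le> 4 / real (Suc N)" by simp
      also have "\<dots> < e\<^sup>2"
        using N1 e by (simp add: field_simps)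
      finally show ?thesis
        using e by (simp add: dist_norm power_less_imp_less_base)
    qed
    then show "\<exists>M. \<forall>k\<ge>M. \<forall>l\<ge>M. dist (X k) (X l) < e" by blast
  qed
  then obtain z where z: "X \<longlonglongrightarrow> z" by (auto simp: Cauchy_convergent_iff convergent_def)
  have "(\<lambda>n. f (X n)) \<longlonglongrightarrow> f z" by (rule f.tendsto [OF z])
  then have fz: "f z = 1" using X(1) by (simp add: LIMSEQ_const_iff)
  have "(norm z)\<^sup>2 \<le> m + 0"
  proof (rule LIMSEQ_le)
    show "(\<lambda>n. (norm (X n))\<^sup>2) \<longlonglongrightarrow> (norm z)\<^sup>2" by (intro tendsto_intros z)
    show "(\<lambda>n. m + 1 / real (Suc n)) \<longlonglongrightarrow> m + 0"
      by (intro tendsto_intros LIMSEQ_Suc lim_1_over_n)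
    show "\<exists>N. \<forall>n\<ge>N. (norm (X n))\<^sup>2 \<le> m + 1 / real (Suc n)"
      using X(2) by (auto intro: less_imp_le)
  qed
  then have "(norm z)\<^sup>2 \<le> (norm x)\<^sup>2" if "f x = 1" for x
    using m_le [OF that] by linarith
  then have "norm z \<le> norm x" if "f x = 1" for x
    using that by (blast intro: power2_le_imp_le norm_ge_zero)
  with fz show ?thesis by blast
qed

text \<open>
  The vector of minimal norm on the hyperplane \<open>f = 1\<close> is orthogonal to the kernel of \<open>f\<close>, and every
  \<open>x\<close> differs from a multiple of it by an element of that kernel.
\<close>

lemma riesz_representation:
  fixes f :: "'a \<Rightarrow> 'k"
  assumes f: "bounded_linear f" and hom: "\<And>c x. f (smul c x) = c * f x"
  shows "\<exists>z. \<forall>x. f x = ip x z"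
proof (cases "\<forall>x. f x = 0")
  case True
  then show ?thesis by (intro exI [of _ 0]) simp
next
  case False
  interpret f: bounded_linear f by (rule f)
  from False obtain x0 where "f x0 \<noteq> 0" by auto
  then have "f (smul (inverse (f x0)) x0) = 1" by (simp add: hom)
  from exists_minimal_norm [OF f this] obtain z
    where z: "f z = 1" "\<And>x. f x = 1 \<Longrightarrow> norm z \<le> norm x" by blast
  have orth: "ip z w = 0" if "f w = 0" for w
    by (rule minimal_imp_orthogonal, rule z) (simp add: f.add hom z that)
  have z0: "z \<noteq> 0" using z(1) by auto
  have "f x = ip x (inverse ((norm z)\<^sup>2) *\<^sub>R z)" for x
  proof -
    have "f (x - smul (f x) z) = 0" by (simp add: f.diff hom z)
    then have "ip (x - smul (f x) z) z = 0"
      using orth [of "x - smul (f x) z"] ip_commute [of "x - smul (f x) z" z] by simp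
    then have "ip x z = f x * of_real ((norm z)\<^sup>2)"
      by (simp add: ip_diff_left ip_smul_left ip_self)
    then show ?thesis using z0 by (simp add: ip_scaleR_right)
  qed
  then show ?thesis by blast
qed

lemma ip_eqI:
  assumes "\<And>x. ip x y = ip x z"
  shows "y = z"
proof -
  have "of_real ((norm (y - z))\<^sup>2) = (0::'k)"
    unfolding ip_self [symmetric] ip_diff_right assms by simp
  then show ?thesis by simp
qed

end

lemma adjoint_op:
  fixes scX :: "'k::rc_field \<Rightarrow> 'x::banach \<Rightarrow> 'x" and scY :: "'k \<Rightarrow> 'y::banach \<Rightarrow> 'y"
  assumes "hilbert_space scX ipX" and "hilbert_space scY ipY"
    and "Vector_Spaces.linear scX scY K" and "bounded_linear K"
  shows "ipY (K x) y = ipX x (adjoint_op ipX ipY K y)"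
proof -
  interpret X: hilbert_space scX ipX by fact
  interpret Y: hilbert_space scY ipY by fact
  interpret K: Vector_Spaces.linear scX scY K by fact
  have "bounded_linear (\<lambda>x. ipY (K x) y)"
    using bounded_linear_compose [OF Y.bounded_linear_ip_left \<open>bounded_linear K\<close>] .
  then have "\<exists>z. \<forall>x. ipY (K x) y = ipX x z"
    by (rule X.riesz_representation) (simp add: K.scale Y.ip_smul_left)
  then have "\<exists>!z. \<forall>x. ipY (K x) y = ipX x z"
    using X.ip_eqI by metis
  then have "\<forall>x. ipY (K x) y = ipX x (THE z. \<forall>x. ipY (K x) y = ipX x z)" by (rule theI')
  then show ?thesis unfolding adjoint_op_def by (rule spec)
qed

section \<open>Frames\<close>

text \<open>
  The series need not converge absolutely; its blocks are controlled by the tails of the summable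
  family \<open>q\<close>, so that its partial sums form a Cauchy net.
\<close>

lemma summable_on_square_dominated:
  fixes f :: "'i \<Rightarrow> 'a::banach" and q :: "'i \<Rightarrow> real"
  assumes q: "q summable_on I" and q0: "\<And>i. i \<in> I \<Longrightarrow> 0 \<le> q i" and C: "0 \<le> C"
    and f: "\<And>F. finite F \<Longrightarrow> F \<subseteq> I \<Longrightarrow> (norm (sum f F))\<^sup>2 \<le> C * sum q F"
  shows "f summable_on I"
proof -
  have "\<exists>P. eventually P (finite_subsets_at_top I) \<and>
      (\<forall>F G. P F \<and> P G \<longrightarrow> dist (sum f F) (sum f G) < e)" if e: "0 < e" for e
  proof -
    define d where "d = e\<^sup>2 / (4 * (C + 1))"
    have d: "0 < d" using e C by (simp add: d_def)
    have Cd: "C * d < (e / 2)\<^sup>2"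
      using e C by (simp add: d_def field_simps power2_eq_square)
    obtain F0 where F0: "finite F0" "F0 \<subseteq> I" "dist (sum q F0) (infsum q I) \<le> d"
      using has_sum_finite_approximation [OF has_sum_infsum [OF q] d] by blast
    have close: "dist (sum f F) (sum f F0) < e / 2" if F: "finite F" "F0 \<subseteq> F" "F \<subseteq> I" for F
    proof -
      have "sum q F \<le> infsum q I"
        by (rule finite_sum_le_infsum [OF q]) (use F q0 in auto)
      then have "sum q (F - F0) \<le> d"
        using F F0 by (simp add: sum_diff dist_real_def)
      then have "C * sum q (F - F0) \<le> C * d" using C by (rule mult_left_mono)
      moreover have "(norm (sum f (F - F0)))\<^sup>2 \<le> C * sum q (F - F0)"
        using F by (intro f) auto
      ultimately have "(norm (sum f (F - F0)))\<^sup>2 < (e / 2)\<^sup>2"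
        using Cd by linarith
      then have "norm (sum f (F - F0)) < e / 2"
        by (rule power_less_imp_less_base) (use e in simp)
      then show ?thesis
        using F F0 by (simp add: sum_diff dist_norm)
    qed
    show ?thesis
    proof (intro exI conjI allI impI)
      show "eventually (\<lambda>F. finite F \<and> F0 \<subseteq> F \<and> F \<subseteq> I) (finite_subsets_at_top I)"
        unfolding eventually_finite_subsets_at_top using F0 by blast
    next
      fix F G
      assume "(finite F \<and> F0 \<subseteq> F \<and> F \<subseteq> I) \<and> (finite G \<and> F0 \<subseteq> G \<and> G \<subseteq> I)"
      then show "dist (sum f F) (sum f G) < e"
        using close [of F] close [of G] by (auto intro: dist_triangle_half_l [of _ "sum f F0"])
    qed
  qed
  then have "cauchy_filter (filtermap (sum f) (finite_subsets_at_top I))"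
    by (simp add: cauchy_filter_metric_filtermap)
  moreover have "complete (UNIV :: 'a set)" by (rule complete_UNIV)
  ultimately obtain L where "(sum f \<longlongrightarrow> L) (finite_subsets_at_top I)"
    using complete_uniform [where S = "UNIV :: 'a set"] by (force simp add: filterlim_def)
  then show ?thesis
    using summable_on_def has_sum_def by blast
qed

lemma has_sum_in_closed:
  fixes f :: "'i \<Rightarrow> 'a::real_normed_vector"
  assumes "(f has_sum s) I" and "closed S" and "\<And>F. finite F \<Longrightarrow> F \<subseteq> I \<Longrightarrow> sum f F \<in> S"
  shows "s \<in> S"
proof (rule Lim_in_closed_set [OF assms(2)])
  show "\<forall>\<^sub>F F in finite_subsets_at_top I. sum f F \<in> S"
    by (rule eventually_finite_subsets_at_top_weakI) (rule assms(3))
  show "(sum f \<longlongrightarrow> s) (finite_subsets_at_top I)"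
    using assms(1) by (simp add: has_sum_def)
qed simp

lemma has_sum_norm_le:
  fixes f :: "'i \<Rightarrow> 'a::real_normed_vector"
  assumes "(f has_sum s) I" and "\<And>F. finite F \<Longrightarrow> F \<subseteq> I \<Longrightarrow> norm (sum f F) \<le> b"
  shows "norm s \<le> b"
  using has_sum_in_closed [OF assms(1) closed_cball, of 0 b] assms(2) by simp

lemma (in hilbert_space) subspace_closure:
  assumes "subspace S"
  shows "subspace (closure S)"
proof (rule subspaceI)
  show "0 \<in> closure S"
    using subspace_0 [OF assms] closure_subset by blast
next
  fix x y assume "x \<in> closure S" "y \<in> closure S"
  then obtain X Y where "\<And>n. X n \<in> S" "X \<longlonglongrightarrow> x" "\<And>n. Y n \<in> S" "Y \<longlonglongrightarrow> y"
    unfolding closure_sequential by blast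
  then show "x + y \<in> closure S"
    unfolding closure_sequential
    by (intro exI [of _ "\<lambda>n. X n + Y n"]) (auto intro: tendsto_add subspace_add [OF assms])
next
  fix c x assume "x \<in> closure S"
  then obtain X where "\<And>n. X n \<in> S" "X \<longlonglongrightarrow> x"
    unfolding closure_sequential by blast
  then show "smul c x \<in> closure S"
    unfolding closure_sequential
    by (intro exI [of _ "\<lambda>n. smul c (X n)"])
      (auto intro: bounded_linear.tendsto [OF bounded_linear_smul_right] subspace_scale [OF assms])
qed

locale bessel_family = hilbert_space smul ip
  for smul :: "'k::rc_field \<Rightarrow> 'a::banach \<Rightarrow> 'a" and ip :: "'a \<Rightarrow> 'a \<Rightarrow> 'k" +
  fixes \<Lambda> :: "'i set" and w :: "'i \<Rightarrow> 'a" and H :: "'a set" and B :: real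
  assumes subspace_H: "subspace H"
    and w_mem: "\<And>i. i \<in> \<Lambda> \<Longrightarrow> w i \<in> H"
    and upper_bound: "upper_frame_bound ip \<Lambda> w H B"
begin

abbreviation S :: "'a \<Rightarrow> 'a" where
  "S \<equiv> frame_operator smul ip \<Lambda> w"

abbreviation frame_energy :: "'a \<Rightarrow> real" where
  "frame_energy x \<equiv> (\<Sum>\<^sub>\<infinity>i\<in>\<Lambda>. (norm (ip x (w i)))\<^sup>2)"

lemma B_pos: "0 < B"
  using upper_bound by (simp add: upper_frame_bound_def)

lemma synthesis_mem: "F \<subseteq> \<Lambda> \<Longrightarrow> (\<Sum>i\<in>F. smul (c i) (w i)) \<in> H"
  by (intro subspace_sum subspace_scale subspace_H w_mem) auto

text \<open>
  The synthesis map is the adjoint of the analysis map on \<open>H\<close>, hence inherits its norm bound.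
\<close>

lemma synthesis_bound:
  assumes "finite F" and "F \<subseteq> \<Lambda>"
  shows "(norm (\<Sum>i\<in>F. smul (c i) (w i)))\<^sup>2 \<le> B * (\<Sum>i\<in>F. (norm (c i))\<^sup>2)"
proof -
  define z where "z = (\<Sum>i\<in>F. smul (c i) (w i))"
  define p where "p = (\<Sum>i\<in>F. (norm (c i))\<^sup>2)"
  have p: "0 \<le> p" by (simp add: p_def sum_nonneg)
  have "z \<in> H" using assms by (simp add: z_def synthesis_mem)
  then have sm: "(\<lambda>i. (norm (ip z (w i)))\<^sup>2) summable_on \<Lambda>" "frame_energy z \<le> B * (norm z)\<^sup>2"
    using upper_bound by (auto simp: upper_frame_bound_def)
  have "(\<Sum>i\<in>F. (norm (ip z (w i)))\<^sup>2) \<le> B * (norm z)\<^sup>2"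
    using finite_sum_le_infsum [OF sm(1) assms] sm(2) by simp
  then have q: "p * (\<Sum>i\<in>F. (norm (ip z (w i)))\<^sup>2) \<le> p * (B * (norm z)\<^sup>2)"
    using p by (rule mult_left_mono)
  have "ip z z = (\<Sum>i\<in>F. c i * ip (w i) z)"
    by (subst (1) z_def) (simp add: ip_sum_left ip_smul_left)
  then have "norm (of_real ((norm z)\<^sup>2) :: 'k) = norm (\<Sum>i\<in>F. c i * ip (w i) z)"
    unfolding ip_self by (rule arg_cong)
  then have "(norm z)\<^sup>2 = norm (\<Sum>i\<in>F. c i * ip (w i) z)"
    unfolding norm_of_real by simp
  also have "\<dots> \<le> (\<Sum>i\<in>F. norm (c i) * norm (ip z (w i)))"
    by (rule sum_norm_le) (simp add: norm_mult norm_ip_commute)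
  finally have "((norm z)\<^sup>2)\<^sup>2 \<le> (\<Sum>i\<in>F. norm (c i) * norm (ip z (w i)))\<^sup>2"
    by (rule power_mono) simp
  also have "\<dots> \<le> p * (\<Sum>i\<in>F. (norm (ip z (w i)))\<^sup>2)"
    unfolding p_def by (rule Cauchy_Schwarz_ineq_sum)
  also note q
  finally have "(norm z)\<^sup>2 * (norm z)\<^sup>2 \<le> (B * p) * (norm z)\<^sup>2"
    by (simp add: power2_eq_square ac_simps)
  then have "(norm z)\<^sup>2 \<le> B * p"
    using p B_pos mult_right_le_imp_le [of "(norm z)\<^sup>2" "(norm z)\<^sup>2" "B * p"] by (cases "z = 0") auto
  then show ?thesis by (simp add: z_def p_def)
qed

text \<open>
  The upper bound on \<open>H\<close> extends to the whole space, because the orthogonal complement of \<open>H\<close> is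
  invisible to the family; going through the synthesis map avoids the orthogonal projection.
\<close>

lemma bessel_finite:
  assumes "finite F" and "F \<subseteq> \<Lambda>"
  shows "(\<Sum>i\<in>F. (norm (ip x (w i)))\<^sup>2) \<le> B * (norm x)\<^sup>2"
proof -
  define s where "s = (\<Sum>i\<in>F. (norm (ip x (w i)))\<^sup>2)"
  define z where "z = (\<Sum>i\<in>F. smul (ip x (w i)) (w i))"
  have s: "0 \<le> s" by (simp add: s_def sum_nonneg)
  have "ip z x = (\<Sum>i\<in>F. ip x (w i) * sconj (ip x (w i)))"
    unfolding z_def ip_sum_left by (intro sum.cong refl) (metis ip_smul_left ip_commute)
  also have "\<dots> = of_real s"
    by (simp add: mult_sconj_of_real s_def)
  finally have "s = norm (ip z x)" using s by simp
  also have "\<dots> \<le> norm z * norm x" by (rule norm_ip_le)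
  finally have "s\<^sup>2 \<le> (norm z * norm x)\<^sup>2" using s by (rule power_mono)
  also have "\<dots> = (norm z)\<^sup>2 * (norm x)\<^sup>2" by (rule power_mult_distrib)
  also have "\<dots> \<le> (B * s) * (norm x)\<^sup>2"
    unfolding z_def s_def by (intro mult_right_mono synthesis_bound assms) simp
  finally have "s * s \<le> (B * (norm x)\<^sup>2) * s"
    by (simp add: power2_eq_square ac_simps)
  then have "s \<le> B * (norm x)\<^sup>2"
    using s B_pos by (cases "s = 0") (auto simp: mult_le_cancel_right)
  then show ?thesis by (simp add: s_def)
qed

lemma bessel_summable: "(\<lambda>i. (norm (ip x (w i)))\<^sup>2) summable_on \<Lambda>"
  by (rule nonneg_bdd_above_summable_on)
    (auto intro!: bdd_aboveI [of _ "B * (norm x)\<^sup>2"] bessel_finite)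

lemma bessel: "frame_energy x \<le> B * (norm x)\<^sup>2"
  by (rule infsum_le_finite_sums [OF bessel_summable bessel_finite])

lemma frame_energy_nonneg: "0 \<le> frame_energy x"
  by (rule infsum_nonneg) simp

lemma finite_sum_le_energy:
  "finite F \<Longrightarrow> F \<subseteq> \<Lambda> \<Longrightarrow> (\<Sum>i\<in>F. (norm (ip x (w i)))\<^sup>2) \<le> frame_energy x"
  by (rule finite_sum_le_infsum [OF bessel_summable]) auto

lemma has_sum_S: "((\<lambda>i. smul (ip x (w i)) (w i)) has_sum S x) \<Lambda>"
proof -
  have "(\<lambda>i. smul (ip x (w i)) (w i)) summable_on \<Lambda>"
    by (rule summable_on_square_dominated [OF bessel_summable [of x] _ less_imp_le [OF B_pos]])
      (use synthesis_bound in auto)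
  then show ?thesis by (simp add: frame_operator_def)
qed

lemma has_sum_mem_closure:
  assumes "J \<subseteq> \<Lambda>" and "subspace T" and "\<And>i. i \<in> J \<Longrightarrow> w i \<in> T"
    and "((\<lambda>i. smul (c i) (w i)) has_sum s) J"
  shows "s \<in> closure T"
proof (rule has_sum_in_closed [OF assms(4) closed_closure])
  fix F assume "finite F" "F \<subseteq> J"
  then have "(\<Sum>i\<in>F. smul (c i) (w i)) \<in> T"
    using assms by (intro subspace_sum subspace_scale) auto
  then show "(\<Sum>i\<in>F. smul (c i) (w i)) \<in> closure T"
    using closure_subset by blast
qed

lemma norm_S_le: "norm (S x) \<le> B * norm x"
proof (rule has_sum_norm_le [OF has_sum_S])
  fix F assume F: "finite F" "F \<subseteq> \<Lambda>"
  have "(norm (\<Sum>i\<in>F. smul (ip x (w i)) (w i)))\<^sup>2 \<le> B * (\<Sum>i\<in>F. (norm (ip x (w i)))\<^sup>2)"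
    by (rule synthesis_bound [OF F])
  also have "\<dots> \<le> B * (B * (norm x)\<^sup>2)"
    using bessel_finite [OF F] B_pos by (intro mult_left_mono) auto
  also have "\<dots> = (B * norm x)\<^sup>2" by (simp add: power2_eq_square ac_simps)
  finally show "norm (\<Sum>i\<in>F. smul (ip x (w i)) (w i)) \<le> B * norm x"
    by (rule power2_le_imp_le) (use B_pos in auto)
qed

lemma S_add: "S (x + y) = S x + S y"
proof -
  have "((\<lambda>i. smul (ip (x + y) (w i)) (w i)) has_sum S x + S y) \<Lambda>"
    using has_sum_add [OF has_sum_S has_sum_S, of x y]
    by (simp add: ip_add_left scale_left_distrib)
  then show ?thesis using has_sum_S has_sum_unique by blast
qed

lemma S_smul: "S (smul c x) = smul c (S x)"
proof -
  have "((\<lambda>i. smul (ip (smul c x) (w i)) (w i)) has_sum smul c (S x)) \<Lambda>"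
    using has_sum_bounded_linear [OF bounded_linear_smul_right [of c] has_sum_S [of x]]
    by (simp add: ip_smul_left)
  then show ?thesis using has_sum_S has_sum_unique by blast
qed

lemma bounded_linear_S: "bounded_linear S"
proof (rule bounded_linear_intro [where K = B])
  show "S (r *\<^sub>R x) = r *\<^sub>R S x" for r x
    using S_smul [of "of_real r" x] by (simp add: smul_of_real)
qed (auto simp: S_add norm_S_le mult.commute)

lemma ip_S_self: "ip (S x) x = of_real (frame_energy x)"
proof -
  have "((\<lambda>i. ip (smul (ip x (w i)) (w i)) x) has_sum ip (S x) x) \<Lambda>"
    by (rule has_sum_bounded_linear [OF bounded_linear_ip_left has_sum_S])
  moreover have "ip (smul (ip x (w i)) (w i)) x = of_real ((norm (ip x (w i)))\<^sup>2)" for i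
    unfolding mult_sconj_of_real [symmetric] ip_smul_left by (metis ip_commute)
  moreover have "((\<lambda>i. of_real ((norm (ip x (w i)))\<^sup>2)) has_sum (of_real (frame_energy x) :: 'k)) \<Lambda>"
    by (rule has_sum_bounded_linear [OF bounded_linear_of_real has_sum_infsum [OF bessel_summable]])
  ultimately show ?thesis by (simp only: has_sum_unique)
qed

end

locale hilbert_frame = bessel_family smul ip \<Lambda> w H B
  for smul :: "'k::rc_field \<Rightarrow> 'a::banach \<Rightarrow> 'a" and ip :: "'a \<Rightarrow> 'a \<Rightarrow> 'k"
    and \<Lambda> :: "'i set" and w :: "'i \<Rightarrow> 'a" and H :: "'a set" and B :: real +
  fixes A :: real
  assumes closed_H: "closed H"
    and lower_bound: "lower_frame_bound ip \<Lambda> w H A"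
begin

abbreviation dual :: "'i \<Rightarrow> 'a" where
  "dual \<equiv> dual_frame smul ip \<Lambda> w H"

lemma A_pos: "0 < A"
  using lower_bound by (simp add: lower_frame_bound_def)

lemma frame_lower: "x \<in> H \<Longrightarrow> A * (norm x)\<^sup>2 \<le> frame_energy x"
  using lower_bound by (simp add: lower_frame_bound_def)

lemma S_mem: "S x \<in> H"
  using has_sum_mem_closure [OF order_refl subspace_H w_mem has_sum_S] closed_H by simp

text \<open>
  With the step size \<open>c = A / B\<^sup>2\<close>, the identity
  \<open>\<parallel>x - c S x\<parallel>\<^sup>2 = \<parallel>x\<parallel>\<^sup>2 - 2 c \<langle>S x, x\<rangle> + c\<^sup>2 \<parallel>S x\<parallel>\<^sup>2\<close> makes the Richardson iteration for \<open>S x = z\<close>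
  a contraction.  The maximum with 0 is needed when \<open>H\<close> is trivial, where \<open>A\<close> may exceed \<open>B\<close>.
\<close>

lemma richardson_contraction:
  assumes "x \<in> H"
  shows "norm (x - (A / B\<^sup>2) *\<^sub>R S x) \<le> sqrt (max 0 (1 - A\<^sup>2 / B\<^sup>2)) * norm x"
proof -
  define c where "c = A / B\<^sup>2"
  have c: "0 < c" using A_pos B_pos by (simp add: c_def)
  have S': "ip x (S x) = of_real (frame_energy x)"
    using ip_commute [of x "S x"] by (simp add: ip_S_self)
  have "ip (x - c *\<^sub>R S x) (x - c *\<^sub>R S x)
      = ip x x - of_real c * ip (S x) x - (of_real c * ip x (S x) - of_real c * (of_real c * ip (S x) (S x)))"
    by (simp add: ip_diff_left ip_diff_right ip_scaleR_left ip_scaleR_right right_diff_distrib)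
  then have "(of_real ((norm (x - c *\<^sub>R S x))\<^sup>2) :: 'k)
      = of_real ((norm x)\<^sup>2 - 2 * c * frame_energy x + c\<^sup>2 * (norm (S x))\<^sup>2)"
    unfolding S' ip_S_self unfolding ip_self by (simp add: power2_eq_square algebra_simps)
  then have "(norm (x - c *\<^sub>R S x))\<^sup>2 = (norm x)\<^sup>2 - 2 * c * frame_energy x + c\<^sup>2 * (norm (S x))\<^sup>2"
    unfolding of_real_eq_iff .
  also have "\<dots> \<le> (norm x)\<^sup>2 - 2 * c * (A * (norm x)\<^sup>2) + c\<^sup>2 * (B * norm x)\<^sup>2"
    using frame_lower [OF assms] norm_S_le [of x] c
    by (intro add_mono diff_mono mult_left_mono power_mono) auto
  also have "\<dots> = (1 - A\<^sup>2 / B\<^sup>2) * (norm x)\<^sup>2"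
    using B_pos by (simp add: c_def field_simps power2_eq_square)
  also have "\<dots> \<le> max 0 (1 - A\<^sup>2 / B\<^sup>2) * (norm x)\<^sup>2"
    by (intro mult_right_mono) auto
  also have "\<dots> = (sqrt (max 0 (1 - A\<^sup>2 / B\<^sup>2)) * norm x)\<^sup>2"
    by (simp add: power_mult_distrib)
  finally show ?thesis
    unfolding c_def by (rule power2_le_imp_le) auto
qed

lemma inj_on_S: "inj_on S H"
proof (rule inj_onI)
  fix x y assume xy: "x \<in> H" "y \<in> H" "S x = S y"
  then have "S (x - y) = 0"
    by (simp add: bounded_linear.axioms linear_simps(2) [OF bounded_linear_S])
  then have "(of_real (frame_energy (x - y)) :: 'k) = 0"
    unfolding ip_S_self [symmetric] by simp
  then have "A * (norm (x - y))\<^sup>2 \<le> 0"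
    using frame_lower [OF subspace_diff [OF subspace_H xy(1,2)]] by simp
  then show "x = y" using A_pos by (simp add: mult_le_0_iff)
qed

lemma surj_S: "z \<in> H \<Longrightarrow> \<exists>x\<in>H. S x = z"
proof -
  assume z: "z \<in> H"
  define f where "f x = x - (A / B\<^sup>2) *\<^sub>R (S x - z)" for x
  have fd: "f x - f y = (x - y) - (A / B\<^sup>2) *\<^sub>R S (x - y)" for x y
    by (simp add: f_def linear_simps(2) [OF bounded_linear_S] algebra_simps)
  have mem: "f x \<in> H" if "x \<in> H" for x
    unfolding f_def smul_of_real [symmetric]
    by (intro subspace_diff subspace_scale subspace_H that S_mem z)
  have "\<exists>!x\<in>H. f x = x"
  proof (rule Banach_fix)
    show "complete H" using closed_H by (simp add: complete_eq_closed)
    show "H \<noteq> {}" using z by blast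
    show "f ` H \<subseteq> H" using mem by blast
    show "0 \<le> sqrt (max 0 (1 - A\<^sup>2 / B\<^sup>2))" by simp
    show "sqrt (max 0 (1 - A\<^sup>2 / B\<^sup>2)) < 1" using A_pos B_pos by (auto simp: max_def)
    show "dist (f x) (f y) \<le> sqrt (max 0 (1 - A\<^sup>2 / B\<^sup>2)) * dist x y" if "x \<in> H" "y \<in> H" for x y
      unfolding dist_norm fd by (intro richardson_contraction subspace_diff subspace_H that)
  qed
  then obtain x where "x \<in> H" "f x = x" by blast
  then show ?thesis using A_pos B_pos by (auto simp: f_def)
qed

lemma bij_betw_S: "bij_betw S H H"
  unfolding bij_betw_def using inj_on_S surj_S S_mem by (auto simp: image_def)

lemma dual_mem: "i \<in> \<Lambda> \<Longrightarrow> dual i \<in> H"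
  unfolding dual_frame_def
  using the_inv_into_into [OF inj_on_S, of "w i" H] bij_betw_S w_mem by (auto simp: bij_betw_def)

lemma S_dual: "i \<in> \<Lambda> \<Longrightarrow> S (dual i) = w i"
  unfolding dual_frame_def by (rule f_the_inv_into_f_bij_betw [OF bij_betw_S w_mem])

text \<open>
  For \<open>z = \<Sum> c\<^sub>i S\<^sup>-\<^sup>1 w\<^sub>i\<close>, the frame energy of \<open>z\<close> is \<open>\<langle>S z, z\<rangle> = \<Sum> c\<^sub>i \<langle>w\<^sub>i, z\<rangle>\<close>, hence is at most
  the square sum of the coefficients by the Cauchy-Schwarz inequality; the lower frame bound turns
  this into a bound on the norm.
\<close>

lemma dual_synthesis_bound:
  assumes "finite F" and "F \<subseteq> \<Lambda>"
  shows "A * (norm (\<Sum>i\<in>F. smul (c i) (dual i)))\<^sup>2 \<le> (\<Sum>i\<in>F. (norm (c i))\<^sup>2)"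
proof -
  define z where "z = (\<Sum>i\<in>F. smul (c i) (dual i))"
  define p where "p = (\<Sum>i\<in>F. (norm (c i))\<^sup>2)"
  have p: "0 \<le> p" by (simp add: p_def sum_nonneg)
  have zH: "z \<in> H"
    unfolding z_def using assms by (intro subspace_sum subspace_scale subspace_H dual_mem) auto
  have "S z = (\<Sum>i\<in>F. smul (c i) (S (dual i)))"
    by (simp add: z_def Real_Vector_Spaces.linear_sum [OF bounded_linear.linear [OF bounded_linear_S]] S_smul)
  also have "\<dots> = (\<Sum>i\<in>F. smul (c i) (w i))"
    using assms by (intro sum.cong refl) (auto simp: S_dual)
  finally have "of_real (frame_energy z) = (\<Sum>i\<in>F. c i * ip (w i) z)"
    unfolding ip_S_self [symmetric] by (simp add: ip_sum_left ip_smul_left)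
  then have "norm (of_real (frame_energy z) :: 'k) = norm (\<Sum>i\<in>F. c i * ip (w i) z)"
    by (rule arg_cong)
  then have "frame_energy z = norm (\<Sum>i\<in>F. c i * ip (w i) z)"
    using frame_energy_nonneg [of z] by simp
  also have "\<dots> \<le> (\<Sum>i\<in>F. norm (c i) * norm (ip z (w i)))"
    by (rule sum_norm_le) (simp add: norm_mult norm_ip_commute)
  finally have "(frame_energy z)\<^sup>2 \<le> (\<Sum>i\<in>F. norm (c i) * norm (ip z (w i)))\<^sup>2"
    by (rule power_mono) (rule frame_energy_nonneg)
  also have "\<dots> \<le> p * (\<Sum>i\<in>F. (norm (ip z (w i)))\<^sup>2)"
    unfolding p_def by (rule Cauchy_Schwarz_ineq_sum)
  also have "\<dots> \<le> p * frame_energy z"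
    by (rule mult_left_mono [OF finite_sum_le_energy [OF assms] p])
  finally have "frame_energy z \<le> p"
    using p frame_energy_nonneg [of z]
    by (cases "frame_energy z = 0") (auto simp: power2_eq_square mult_le_cancel_right)
  with frame_lower [OF zH] show ?thesis by (simp add: z_def p_def)
qed

lemma dual_series:
  assumes D: "0 \<le> D" and bound: "\<And>F. finite F \<Longrightarrow> F \<subseteq> \<Lambda> \<Longrightarrow> (\<Sum>i\<in>F. (norm (c i))\<^sup>2) \<le> D\<^sup>2"
  shows "(\<lambda>i. smul (c i) (dual i)) summable_on \<Lambda>"
    and "norm (\<Sum>\<^sub>\<infinity>i\<in>\<Lambda>. smul (c i) (dual i)) \<le> sqrt (inverse A) * D"
proof -
  have syn: "(norm (\<Sum>i\<in>F. smul (c i) (dual i)))\<^sup>2 \<le> inverse A * (\<Sum>i\<in>F. (norm (c i))\<^sup>2)"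
    if "finite F" "F \<subseteq> \<Lambda>" for F
    using dual_synthesis_bound [OF that, of c] A_pos by (simp add: field_simps)
  show sm: "(\<lambda>i. smul (c i) (dual i)) summable_on \<Lambda>"
  proof (rule summable_on_square_dominated [OF _ _ _ syn])
    show "(\<lambda>i. (norm (c i))\<^sup>2) summable_on \<Lambda>"
      by (rule nonneg_bdd_above_summable_on) (auto intro!: bdd_aboveI [of _ "D\<^sup>2"] bound)
  qed (use A_pos in auto)
  show "norm (\<Sum>\<^sub>\<infinity>i\<in>\<Lambda>. smul (c i) (dual i)) \<le> sqrt (inverse A) * D"
  proof (rule has_sum_norm_le [OF has_sum_infsum [OF sm]])
    fix F assume F: "finite F" "F \<subseteq> \<Lambda>"
    have "(norm (\<Sum>i\<in>F. smul (c i) (dual i)))\<^sup>2 \<le> inverse A * D\<^sup>2"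
      by (rule order.trans [OF syn [OF F]], rule mult_left_mono [OF bound [OF F]])
        (use A_pos in simp)
    also have "\<dots> = (sqrt (inverse A) * D)\<^sup>2"
      using A_pos by (simp add: power_mult_distrib)
    finally show "norm (\<Sum>i\<in>F. smul (c i) (dual i)) \<le> sqrt (inverse A) * D"
      by (rule power2_le_imp_le) (use A_pos D in auto)
  qed
qed

lemma dual_reconstruction:
  assumes "x \<in> H"
  shows "((\<lambda>i. smul (ip x (w i)) (dual i)) has_sum x) \<Lambda>"
proof -
  define x' where "x' = (\<Sum>\<^sub>\<infinity>i\<in>\<Lambda>. smul (ip x (w i)) (dual i))"
  have "(\<lambda>i. smul (ip x (w i)) (dual i)) summable_on \<Lambda>"
    by (rule dual_series(1) [where D = "sqrt (B * (norm x)\<^sup>2)"])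
      (use B_pos bessel_finite in auto)
  then have x': "((\<lambda>i. smul (ip x (w i)) (dual i)) has_sum x') \<Lambda>"
    by (simp add: x'_def)
  have "x' \<in> H"
    by (rule has_sum_in_closed [OF x' closed_H])
      (auto intro!: subspace_sum subspace_scale subspace_H dual_mem)
  have "((\<lambda>i. S (smul (ip x (w i)) (dual i))) has_sum S x') \<Lambda>"
    by (rule has_sum_bounded_linear [OF bounded_linear_S x'])
  moreover have "S (smul (ip x (w i)) (dual i)) = smul (ip x (w i)) (w i)" if "i \<in> \<Lambda>" for i
    by (simp add: S_smul S_dual that)
  ultimately have "((\<lambda>i. smul (ip x (w i)) (w i)) has_sum S x') \<Lambda>"
    by (simp cong: has_sum_cong)
  then have "S x' = S x" using has_sum_S has_sum_unique by blast
  then have "x' = x" using inj_on_S \<open>x' \<in> H\<close> assms by (auto dest: inj_onD)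
  with x' show ?thesis by simp
qed

text \<open>
  Expanding \<open>w\<^sub>j = S (dual j)\<close> gives \<open>(1 - \<langle>dual j, w\<^sub>j\<rangle>) w\<^sub>j = \<Sum>\<^sub>i\<^sub>\<noteq>\<^sub>j \<langle>dual j, w\<^sub>i\<rangle> w\<^sub>i\<close>; by minimality the
  factor on the left vanishes.  The frame energy of \<open>dual j\<close> is \<open>\<langle>w\<^sub>j, dual j\<rangle> = 1\<close> and is already
  attained at the index \<open>j\<close>.
\<close>

lemma minimal_imp_biorthogonal:
  assumes min: "minimal_family smul \<Lambda> w" and i: "i \<in> \<Lambda>" and j: "j \<in> \<Lambda>"
  shows "ip (dual j) (w i) = (if i = j then 1 else 0)"
proof -
  define b where "b = ip (dual j) (w j)"
  let ?T = "span (w ` (\<Lambda> - {j}))"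
  have "((\<lambda>i. smul (ip (dual j) (w i)) (w i)) has_sum (w j - smul b (w j))) (\<Lambda> - {j})"
    using has_sum_Diff [OF has_sum_S [of "dual j"] has_sum_finite [of "{j}"]] j
    by (simp add: S_dual b_def)
  then have mem: "w j - smul b (w j) \<in> closure ?T"
    by (rule has_sum_mem_closure [rotated 3]) (auto intro: span_base)
  have b: "b = 1"
  proof (rule ccontr)
    assume "b \<noteq> 1"
    have "smul (inverse (1 - b)) (w j - smul b (w j)) \<in> closure ?T"
      by (intro subspace_scale subspace_closure subspace_span mem)
    moreover have "w j - smul b (w j) = smul (1 - b) (w j)"
      by (simp add: scale_left_diff_distrib)
    ultimately have "w j \<in> closure ?T" using \<open>b \<noteq> 1\<close> by simp
    then show False using min j by (auto simp: minimal_family_def)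
  qed
  show ?thesis
  proof (cases "i = j")
    case False
    have "ip (w j) (dual j) = sconj b" unfolding b_def by (rule ip_commute)
    then have "ip (S (dual j)) (dual j) = 1"
      using b sconj_of_real [of 1, where 'k = 'k] j by (simp add: S_dual)
    then have "(of_real (frame_energy (dual j)) :: 'k) = of_real 1"
      by (simp add: ip_S_self)
    then have "frame_energy (dual j) = 1" unfolding of_real_eq_iff .
    then have "(\<Sum>l\<in>{i, j}. (norm (ip (dual j) (w l)))\<^sup>2) \<le> 1"
      using finite_sum_le_energy [of "{i, j}" "dual j"] i j by simp
    then have "(norm (ip (dual j) (w i)))\<^sup>2 \<le> 0"
      using False b by (simp add: b_def)
    then show ?thesis using False by simp
  qed (simp add: b b_def [symmetric])
qed

end

section \<open>Index functions\<close>

lemma square_mem_open_dom: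
  assumes "endpoint_cond \<Lambda> \<kappa> a" and "i \<in> \<Lambda>" and "0 < \<kappa> i"
  shows "(\<kappa> i)\<^sup>2 \<in> open_dom a"
proof (cases "(SUP i\<in>\<Lambda>. ereal ((\<kappa> i)\<^sup>2)) < \<infinity>")
  case True
  have "ereal ((\<kappa> i)\<^sup>2) \<le> (SUP i\<in>\<Lambda>. ereal ((\<kappa> i)\<^sup>2))"
    using assms(2) by (rule SUP_upper)
  also have "\<dots> < a" using assms(1) True by (simp add: endpoint_cond_def)
  finally show ?thesis using assms(3) by (simp add: open_dom_def)
next
  case False
  then have "a = \<infinity>" using assms(1) by (simp only: endpoint_cond_def if_False)
  then show ?thesis using assms(3) by (simp add: open_dom_def)
qed

lemma half_open_domI: "\<mu> \<in> open_dom a \<Longrightarrow> \<mu> \<in> half_open_dom a"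
  by (simp add: open_dom_def half_open_dom_def)

locale index_fun =
  fixes a :: ereal and \<phi> :: "real \<Rightarrow> real"
  assumes index: "index_function a \<phi>"
begin

lemma a_pos: "0 < a"
  using index by (simp add: index_function_def)

lemma phi_pos: "\<mu> \<in> open_dom a \<Longrightarrow> 0 < \<phi> \<mu>"
  using index by (simp add: index_function_def)

lemma phi_cont: "continuous_on (open_dom a) \<phi>"
  using index by (simp add: index_function_def)

lemma phi_tendsto: "(\<phi> \<longlongrightarrow> 0) (at_right 0)"
  using index by (simp add: index_function_def)

lemma phi_less: "\<mu> \<in> open_dom a \<Longrightarrow> \<nu> \<in> open_dom a \<Longrightarrow> \<mu> < \<nu> \<Longrightarrow> \<phi> \<mu> < \<phi> \<nu>"
  using index by (simp add: index_function_def strict_mono_on_def)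

lemma inj_phi: "inj_on \<phi> (open_dom a)"
  using index by (auto simp: index_function_def intro: strict_mono_on_imp_inj_on)

lemma open_dom_downward: "\<nu> \<in> open_dom a \<Longrightarrow> 0 < \<mu> \<Longrightarrow> \<mu> \<le> \<nu> \<Longrightarrow> \<mu> \<in> open_dom a"
  unfolding open_dom_def by (auto intro: le_less_trans [of "ereal \<mu>" "ereal \<nu>"])

lemma real_of_ereal_mem:
  assumes "0 \<le> b" and "ereal b < y" and "y < a"
  shows "b < real_of_ereal y" and "real_of_ereal y \<in> open_dom a"
  using assms by (cases y; simp add: open_dom_def)+

lemma at_left_a_neq_bot: "at_left a \<noteq> bot"
proof
  assume "at_left a = bot"
  then have "eventually (\<lambda>_. False) (at_left a)" by simp
  then obtain b where b: "b < a" "\<forall>y>b. \<not> y < a"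
    unfolding eventually_at_left [OF a_pos] by auto
  obtain y where "b < y" "y < a" using dense [OF b(1)] by blast
  with b(2) show False by simp
qed

text \<open>By monotonicity, the limit at the endpoint is a supremum.\<close>

lemma phi_end_eq: "phi_end a \<phi> = (SUP \<mu>\<in>open_dom a. ereal (\<phi> \<mu>))"
  unfolding phi_end_def
proof (rule tendsto_Lim [OF at_left_a_neq_bot], rule order_tendstoI)
  fix l assume "l < (SUP \<mu>\<in>open_dom a. ereal (\<phi> \<mu>))"
  then obtain \<mu> where \<mu>: "\<mu> \<in> open_dom a" "l < ereal (\<phi> \<mu>)"
    by (auto simp: less_SUP_iff)
  have "l < ereal (\<phi> (real_of_ereal y))" if "ereal \<mu> < y" "y < a" for y
  proof -
    have "\<mu> < real_of_ereal y" "real_of_ereal y \<in> open_dom a"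
      using real_of_ereal_mem [OF _ that] \<mu>(1) by (auto simp: open_dom_def)
    then have "\<phi> \<mu> < \<phi> (real_of_ereal y)" using phi_less \<mu>(1) by blast
    with \<mu>(2) show ?thesis by (metis less_trans less_ereal.simps(1))
  qed
  moreover have "ereal \<mu> < a" using \<mu>(1) by (simp add: open_dom_def)
  ultimately show "\<forall>\<^sub>F y in at_left a. l < ereal (\<phi> (real_of_ereal y))"
    unfolding eventually_at_left [OF a_pos] by blast
next
  fix l assume l: "(SUP \<mu>\<in>open_dom a. ereal (\<phi> \<mu>)) < l"
  have "ereal (\<phi> (real_of_ereal y)) < l" if "0 < y" "y < a" for y
  proof -
    have "real_of_ereal y \<in> open_dom a"
      using real_of_ereal_mem(2) [of 0 y] that by (simp add: zero_ereal_def)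
    then have "ereal (\<phi> (real_of_ereal y)) \<le> (SUP \<mu>\<in>open_dom a. ereal (\<phi> \<mu>))"
      by (rule SUP_upper)
    with l show ?thesis by simp
  qed
  then show "\<forall>\<^sub>F y in at_left a. ereal (\<phi> (real_of_ereal y)) < l"
    unfolding eventually_at_left [OF a_pos] using a_pos by blast
qed

lemma phi_less_end:
  assumes "\<mu> \<in> open_dom a"
  shows "ereal (\<phi> \<mu>) < phi_end a \<phi>"
proof -
  obtain \<nu> where \<nu>: "ereal \<mu> < ereal \<nu>" "ereal \<nu> < a"
    using assms ereal_dense2 [of "ereal \<mu>" a] by (auto simp: open_dom_def)
  then have "\<nu> \<in> open_dom a" using assms by (simp add: open_dom_def)
  then have "ereal (\<phi> \<nu>) \<le> phi_end a \<phi>"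
    unfolding phi_end_eq by (rule SUP_upper)
  moreover have "\<phi> \<mu> < \<phi> \<nu>" using phi_less assms \<open>\<nu> \<in> open_dom a\<close> \<nu>(1) by simp
  ultimately show ?thesis by (metis less_le_trans less_ereal.simps(1))
qed

lemma phi_inv_phi: "\<mu> \<in> open_dom a \<Longrightarrow> phi_inv a \<phi> (\<phi> \<mu>) = \<mu>"
  using phi_less_end [of \<mu>] by (auto simp: phi_inv_def the_inv_into_f_f [OF inj_phi])

lemma phi_mem_Theta_dom: "\<mu> \<in> open_dom a \<Longrightarrow> \<phi> \<mu> \<in> Theta_dom a \<phi>"
  by (simp add: Theta_dom_def phi_pos phi_less_end)

lemma Theta_phi: "\<mu> \<in> open_dom a \<Longrightarrow> Theta a \<phi> (\<phi> \<mu>) = \<phi> \<mu> * \<mu>"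
  by (simp add: Theta_def phi_inv_phi)

text \<open>
  A continuous function that tends to 0 at 0 takes all positive values below any value that it takes.
\<close>

lemma intermediate_value_from_0:
  fixes f :: "real \<Rightarrow> real"
  assumes "continuous_on (open_dom a) f" and "(f \<longlongrightarrow> 0) (at_right 0)"
    and "\<nu> \<in> open_dom a" and "0 < t" and "t < f \<nu>"
  shows "\<exists>\<mu>\<in>open_dom a. f \<mu> = t \<and> \<mu> < \<nu>"
proof -
  have "eventually (\<lambda>\<mu>. f \<mu> < t) (at_right 0)"
    using order_tendstoD(2) [OF assms(2,4)] .
  then obtain b where b: "0 < b" "\<And>\<mu>. 0 < \<mu> \<Longrightarrow> \<mu> < b \<Longrightarrow> f \<mu> < t"
    unfolding eventually_at_right_field by auto
  define m where "m = min (b / 2) (\<nu> / 2)"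
  have \<nu>: "0 < \<nu>" using assms(3) by (simp add: open_dom_def)
  have m: "0 < m" "m < b" "m < \<nu>" using b(1) \<nu> by (auto simp: m_def min_def)
  have sub: "{m..\<nu>} \<subseteq> open_dom a"
    using open_dom_downward [OF assms(3)] m(1) by auto
  have "\<exists>\<mu>\<ge>m. \<mu> \<le> \<nu> \<and> f \<mu> = t"
  proof (rule IVT')
    show "f m \<le> t" using b(2) m by (simp add: less_imp_le)
    show "t \<le> f \<nu>" using assms(5) by simp
    show "m \<le> \<nu>" using m by simp
    show "continuous_on {m..\<nu>} f" using continuous_on_subset [OF assms(1) sub] .
  qed
  then obtain \<mu> where \<mu>: "m \<le> \<mu>" "\<mu> \<le> \<nu>" "f \<mu> = t" by blast
  then have "\<mu> \<noteq> \<nu>" using assms(5) by auto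
  then show ?thesis using \<mu> sub by (intro bexI [of _ \<mu>]) auto
qed

lemma phi_times_id_attains:
  assumes "\<nu> \<in> open_dom a" and "0 < t" and "t < \<phi> \<nu> * \<nu>"
  shows "\<exists>\<mu>\<in>open_dom a. \<phi> \<mu> * \<mu> = t \<and> \<mu> < \<nu>"
proof (rule intermediate_value_from_0 [where f = "\<lambda>\<mu>. \<phi> \<mu> * \<mu>", OF _ _ assms])
  show "continuous_on (open_dom a) (\<lambda>\<mu>. \<phi> \<mu> * \<mu>)"
    by (intro continuous_intros phi_cont)
  have "((\<lambda>\<mu>. \<phi> \<mu> * \<mu>) \<longlongrightarrow> 0 * 0) (at_right 0)"
    by (intro tendsto_mult phi_tendsto tendsto_ident_at)
  then show "((\<lambda>\<mu>. \<phi> \<mu> * \<mu>) \<longlongrightarrow> 0) (at_right 0)" by simp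
qed

lemma Theta_dom_cases:
  assumes "s \<in> Theta_dom a \<phi>"
  obtains (interior) \<mu> where "\<mu> \<in> open_dom a" "s = \<phi> \<mu>"
  | (endpoint) "ereal s = phi_end a \<phi>" "a < \<infinity>"
proof (cases "ereal s < phi_end a \<phi>")
  case True
  then obtain \<nu> where \<nu>: "\<nu> \<in> open_dom a" "s < \<phi> \<nu>"
    unfolding phi_end_eq by (auto simp: less_SUP_iff)
  have "0 < s" using assms by (simp add: Theta_dom_def)
  from intermediate_value_from_0 [OF phi_cont phi_tendsto \<nu>(1) this \<nu>(2)] show ?thesis
    using interior by blast
next
  case False
  then show ?thesis using assms endpoint by (auto simp: Theta_dom_def)
qed

lemma Theta_dom_le_end: "s \<in> Theta_dom a \<phi> \<Longrightarrow> ereal s \<le> phi_end a \<phi>"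
  by (auto simp: Theta_dom_def)

lemma phi_inv_pos:
  assumes "s \<in> Theta_dom a \<phi>"
  shows "0 < phi_inv a \<phi> s"
  using assms
proof (cases rule: Theta_dom_cases)
  case (interior \<mu>)
  then show ?thesis by (simp add: phi_inv_phi) (simp add: open_dom_def)
next
  case endpoint
  then show ?thesis using a_pos by (cases a) (auto simp: phi_inv_def)
qed

text \<open>
  Strict monotonicity persists up to the endpoint value \<open>phi_inv (\<phi>(a)) = a\<close>.  Only the larger of
  two points can be this endpoint.
\<close>

lemma phi_inv_less:
  assumes s: "s \<in> Theta_dom a \<phi>" and t: "t \<in> Theta_dom a \<phi>" and "s < t"
  shows "phi_inv a \<phi> s < phi_inv a \<phi> t"
proof -
  have "ereal s < ereal t" using \<open>s < t\<close> by simp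
  also have "ereal t \<le> phi_end a \<phi>" by (rule Theta_dom_le_end [OF t])
  finally have "ereal s < phi_end a \<phi>" .
  with s obtain \<mu> where \<mu>: "\<mu> \<in> open_dom a" "s = \<phi> \<mu>"
    by (cases rule: Theta_dom_cases) auto
  from t show ?thesis
  proof (cases rule: Theta_dom_cases)
    case (interior \<nu>)
    have "\<mu> < \<nu>"
    proof (rule ccontr)
      assume "\<not> \<mu> < \<nu>"
      then have "\<phi> \<nu> \<le> \<phi> \<mu>"
        using phi_less [OF interior(1) \<mu>(1)] by (cases "\<nu> = \<mu>") auto
      then show False using \<open>s < t\<close> \<mu>(2) interior(2) by simp
    qed
    then show ?thesis using \<mu> interior by (simp add: phi_inv_phi)
  next
    case endpoint
    have "\<mu> < real_of_ereal a"
      using \<mu>(1) endpoint(2) by (cases a) (auto simp: open_dom_def)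
    also have "\<dots> = phi_inv a \<phi> t"
      using endpoint(1) by (simp add: phi_inv_def)
    finally show ?thesis
      unfolding \<mu>(2) phi_inv_phi [OF \<mu>(1)] .
  qed
qed

lemma Theta_less:
  assumes "s \<in> Theta_dom a \<phi>" and "t \<in> Theta_dom a \<phi>" and "s < t"
  shows "Theta a \<phi> s < Theta a \<phi> t"
  unfolding Theta_def
  using assms phi_inv_less [OF assms] phi_inv_pos [OF assms(1)]
  by (intro mult_strict_mono) (auto simp: Theta_dom_def)

lemma inj_Theta: "inj_on (Theta a \<phi>) (Theta_dom a \<phi>)"
  by (rule inj_onI) (metis Theta_less less_irrefl linorder_less_linear)

lemma Theta_inv_Theta: "s \<in> Theta_dom a \<phi> \<Longrightarrow> Theta_inv a \<phi> (Theta a \<phi> s) = s"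
  by (simp add: Theta_inv_def the_inv_into_f_f [OF inj_Theta])

lemma Theta_inv_phi: "\<mu> \<in> open_dom a \<Longrightarrow> Theta_inv a \<phi> (\<phi> \<mu> * \<mu>) = \<phi> \<mu>"
  using Theta_inv_Theta [OF phi_mem_Theta_dom] by (simp add: Theta_phi)

text \<open>
  The strict inequality keeps the parameter away from the endpoint of the domain of \<open>\<phi>\<close>.
\<close>

lemma Theta_range_below:
  assumes t1: "t1 \<in> Theta a \<phi> ` Theta_dom a \<phi>" and t2: "t2 \<in> Theta a \<phi> ` Theta_dom a \<phi>"
    and "t1 < t2"
  obtains \<mu> where "\<mu> \<in> open_dom a" "\<phi> \<mu> * \<mu> = t1" "phi_inv a \<phi> (Theta_inv a \<phi> t1) = \<mu>"
    "\<phi> \<mu> \<le> Theta_inv a \<phi> t2"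
proof -
  obtain s1 s2 where s: "s1 \<in> Theta_dom a \<phi>" "t1 = Theta a \<phi> s1" "s2 \<in> Theta_dom a \<phi>" "t2 = Theta a \<phi> s2"
    using t1 t2 by blast
  have "s1 < s2"
    using s \<open>t1 < t2\<close> Theta_less [of s2 s1] by (cases s1 s2 rule: linorder_cases) auto
  then have "ereal s1 < phi_end a \<phi>"
    using Theta_dom_le_end [OF s(3)] by (metis less_ereal.simps(1) less_le_trans)
  with s(1) obtain \<mu> where \<mu>: "\<mu> \<in> open_dom a" "s1 = \<phi> \<mu>"
    by (cases rule: Theta_dom_cases) auto
  show ?thesis
    by (rule that [of \<mu>])
      (use s \<mu> \<open>s1 < s2\<close> in \<open>auto simp: Theta_inv_Theta Theta_phi Theta_inv_phi phi_inv_phi\<close>)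
qed

end

section \<open>Minimum-norm solutions and optimal frame bounds\<close>

lemma (in hilbert_space) closed_zero_ip: "closed {x. ip x z = 0}"
  by (intro closed_Collect_eq continuous_intros linear_continuous_on bounded_linear_ip_left)

lemma (in hilbert_space) closed_orth_compl: "closed (orth_compl ip T)"
proof -
  have "orth_compl ip T = (\<Inter>z\<in>T. {x. ip x z = 0})"
    by (auto simp: orth_compl_def)
  then show ?thesis by (auto intro: closed_INT closed_zero_ip)
qed

lemma (in hilbert_space) subspace_orth_compl: "subspace (orth_compl ip T)"
  by (rule subspaceI) (auto simp: orth_compl_def ip_add_left ip_smul_left)

text \<open>
  Minimality of the residual in norm makes it orthogonal to the range, and minimality of the
  solution in norm makes it orthogonal to the kernel.
\<close>

lemma moore_penrose_orthogonal:
  fixes scX :: "'k::rc_field \<Rightarrow> 'x::banach \<Rightarrow> 'x" and scY :: "'k \<Rightarrow> 'y::banach \<Rightarrow> 'y"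
  assumes "hilbert_space scX ipX" and "hilbert_space scY ipY"
    and "Vector_Spaces.linear scX scY K" and mp: "moore_penrose_solution K y x"
  shows "x \<in> orth_compl ipX (ker K)" and "h \<in> closure (range K) \<Longrightarrow> ipY (K x) h = ipY y h"
proof -
  interpret X: hilbert_space scX ipX by fact
  interpret Y: hilbert_space scY ipY by fact
  interpret K: Vector_Spaces.linear scX scY K by fact
  have ls: "norm (K x - y) \<le> norm (K z - y)" for z
    using mp by (simp add: moore_penrose_solution_def least_squares_solution_def)
  have min: "norm x \<le> norm z" if "K z = K x" for z
    using mp ls that by (simp add: moore_penrose_solution_def least_squares_solution_def)
  show "x \<in> orth_compl ipX (ker K)"
    unfolding orth_compl_def
    by (auto simp: ker_def K.add K.scale intro!: X.minimal_imp_orthogonal min)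
  have "ipY (K x - y) (K w) = 0" for w
  proof (rule Y.minimal_imp_orthogonal)
    show "norm (K x - y) \<le> norm (K x - y + scY c (K w))" for c
      using ls [of "x + scX c w"] by (simp add: K.add K.scale algebra_simps)
  qed
  then have "ipY (K w) (K x - y) = 0" for w
    using Y.ip_commute [of "K w" "K x - y"] by simp
  then have "closure (range K) \<subseteq> {h. ipY h (K x - y) = 0}"
    by (intro closure_minimal Y.closed_zero_ip) auto
  moreover assume "h \<in> closure (range K)"
  ultimately have "ipY h (K x - y) = 0" by blast
  then have "ipY (K x - y) h = 0" using Y.ip_commute [of "K x - y" h] by simp
  then show "ipY (K x) h = ipY y h" by (simp add: Y.ip_diff_left)
qed

text \<open>
  The square of the infimum over the unit sphere is the best lower frame bound, by scaling.
\<close>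

lemma (in bessel_family) frame_inf_le:
  assumes "y \<in> H"
  shows "frame_inf ip \<Lambda> w H * norm y \<le> sqrt (frame_energy y)"
proof (cases "y = 0")
  case False
  define e where "e = inverse (norm y) *\<^sub>R y"
  have e: "e \<in> H" "norm e = 1"
    using subspace_scale [OF subspace_H assms, of "of_real (inverse (norm y))", unfolded smul_of_real] False
    by (auto simp: e_def)
  have "frame_inf ip \<Lambda> w H \<le> frame_norm ip \<Lambda> w e"
    unfolding frame_inf_def
    by (rule cInf_lower) (use e frame_energy_nonneg in \<open>auto intro!: bdd_belowI [of _ 0] simp: frame_norm_def\<close>)
  moreover have "frame_energy e = (inverse (norm y))\<^sup>2 * frame_energy y"
    by (simp add: e_def ip_scaleR_left norm_mult power_mult_distrib infsum_cmult_right' norm_inverse)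
  then have "sqrt (frame_energy e) = inverse (norm y) * sqrt (frame_energy y)"
    by (simp add: real_sqrt_mult)
  ultimately have "frame_inf ip \<Lambda> w H \<le> inverse (norm y) * sqrt (frame_energy y)"
    by (simp only: frame_norm_def)
  then show ?thesis using False by (simp add: field_simps)
qed simp

lemma (in bessel_family) frame_inf_nonneg:
  assumes "y \<in> H" and "y \<noteq> 0"
  shows "0 \<le> frame_inf ip \<Lambda> w H"
proof -
  have "inverse (norm y) *\<^sub>R y \<in> H" "norm (inverse (norm y) *\<^sub>R y) = 1"
    using subspace_scale [OF subspace_H assms(1), of "of_real (inverse (norm y))", unfolded smul_of_real] assms(2)
    by auto
  then show ?thesis
    unfolding frame_inf_def
    by (intro cInf_greatest) (auto simp: frame_norm_def frame_energy_nonneg)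
qed

section \<open>Error bounds for filtered diagonal frame decompositions\<close>

lemma worst_case_error_le:
  assumes "\<And>x yd. x \<in> M \<Longrightarrow> x \<in> orth_compl ip (ker K) \<Longrightarrow> norm (K x - yd) \<le> \<delta> \<Longrightarrow> norm (R yd - x) \<le> b"
  shows "worst_case_error ip K M \<delta> R \<le> ennreal b"
  unfolding worst_case_error_def by (rule SUP_least) (use assms in \<open>auto intro: ennreal_leI\<close>)

text \<open>
  The data \<open>0\<close> is compatible with both \<open>x\<close> and \<open>-x\<close>, and no reconstruction can be closer than
  \<open>\<parallel>x\<parallel>\<close> to both of them.
\<close>

lemma norm_le_worst_case_error:
  fixes K :: "'x::real_normed_vector \<Rightarrow> 'y::real_normed_vector"
  assumes "x \<in> M \<inter> orth_compl ip (ker K)" and "- x \<in> M \<inter> orth_compl ip (ker K)"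
    and "norm (K x) \<le> \<delta>" and "norm (K (- x)) \<le> \<delta>"
  shows "ennreal (norm x) \<le> worst_case_error ip K M \<delta> R"
proof -
  have le: "ennreal (norm (R 0 - z)) \<le> worst_case_error ip K M \<delta> R"
    if "z \<in> M \<inter> orth_compl ip (ker K)" "norm (K z) \<le> \<delta>" for z
    unfolding worst_case_error_def by (rule SUP_upper2 [of "(z, 0)"]) (use that in auto)
  have "2 * norm x = norm ((R 0 - - x) - (R 0 - x))"
    by (simp flip: scaleR_2)
  also have "\<dots> \<le> norm (R 0 - - x) + norm (R 0 - x)" by (rule norm_triangle_ineq4)
  finally have "norm x \<le> norm (R 0 - - x) \<or> norm x \<le> norm (R 0 - x)" by linarith
  then show ?thesis
    using le [of x] le [of "- x"] assms by (metis ennreal_leI order.trans)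
qed

locale dfd_regularization =
  X: hilbert_space scX ipX + Y: hilbert_space scY ipY + index_fun a \<phi>
  for scX :: "'k::rc_field \<Rightarrow> 'x::banach \<Rightarrow> 'x" and ipX
    and scY :: "'k \<Rightarrow> 'y::banach \<Rightarrow> 'y" and ipY and a \<phi> +
  fixes K :: "'x \<Rightarrow> 'y" and \<Lambda> :: "'i set" and u :: "'i \<Rightarrow> 'x" and v :: "'i \<Rightarrow> 'y"
    and \<kappa> :: "'i \<Rightarrow> real" and g :: "real \<Rightarrow> real \<Rightarrow> real"
    and \<gamma>1 \<gamma>2 E A\<^sub>u B\<^sub>u A\<^sub>v B\<^sub>v :: real
  assumes lin: "Vector_Spaces.linear scX scY K" and bdd: "bounded_linear K"
    and dfd: "is_DFD ipX ipY K \<Lambda> u v \<kappa>"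
    and endp: "endpoint_cond \<Lambda> \<kappa> a"
    and qual: "filter_qualification a \<phi> g \<gamma>1 \<gamma>2"
    and E_pos: "0 < E"
    and lower_u: "lower_frame_bound ipX \<Lambda> u (orth_compl ipX (ker K)) A\<^sub>u"
    and upper_u: "upper_frame_bound ipX \<Lambda> u (orth_compl ipX (ker K)) B\<^sub>u"
    and upper_v: "upper_frame_bound ipY \<Lambda> v (closure (range K)) B\<^sub>v"
    and Av_pos: "0 < A\<^sub>v"
    and Av_less: "A\<^sub>v < (frame_inf ipY \<Lambda> v (closure (range K)))\<^sup>2"
begin

abbreviation "HX \<equiv> orth_compl ipX (ker K)"
abbreviation "HY \<equiv> closure (range K)"
abbreviation "M \<equiv> source_set ipX \<Lambda> u \<kappa> \<phi> E"
abbreviation "R \<equiv> filtered_DFD scX ipX ipY K \<Lambda> u v \<kappa> g"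
abbreviation "vinf \<equiv> frame_inf ipY \<Lambda> v HY"
abbreviation "rate_const \<equiv> sqrt (inverse A\<^sub>u * inverse A\<^sub>v) * (\<gamma>1 * sqrt B\<^sub>v + \<gamma>2 * sqrt A\<^sub>v) * E"

sublocale K: Vector_Spaces.linear scX scY K by (rule lin)

sublocale U: hilbert_frame scX ipX \<Lambda> u HX B\<^sub>u A\<^sub>u
  using dfd upper_u lower_u X.subspace_orth_compl X.closed_orth_compl
  by unfold_locales (auto simp: is_DFD_def is_frame_def)

sublocale V: bessel_family scY ipY \<Lambda> v HY B\<^sub>v
proof unfold_locales
  show "Y.subspace HY"
    using K.subspace_image [OF X.subspace_UNIV] by (rule Y.subspace_closure)
qed (use dfd upper_v in \<open>auto simp: is_DFD_def is_frame_def\<close>)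

lemma kappa_pos: "i \<in> \<Lambda> \<Longrightarrow> 0 < \<kappa> i"
  using dfd by (simp add: is_DFD_def)

lemma kappa_mem: "i \<in> \<Lambda> \<Longrightarrow> (\<kappa> i)\<^sup>2 \<in> open_dom a"
  by (rule square_mem_open_dom [OF endp _ kappa_pos])

lemma phi_kappa_pos: "i \<in> \<Lambda> \<Longrightarrow> 0 < \<phi> ((\<kappa> i)\<^sup>2)"
  by (rule phi_pos [OF kappa_mem])

lemma gamma_pos: "0 < \<gamma>1" "0 < \<gamma>2"
  using qual by (auto simp: filter_qualification_def)

lemma rate_const_pos: "0 < rate_const"
  using gamma_pos U.A_pos V.B_pos Av_pos E_pos by (intro mult_pos_pos add_pos_pos) auto

lemma diagonalization: "i \<in> \<Lambda> \<Longrightarrow> ipY (K x) (v i) = of_real (\<kappa> i) * ipX x (u i)"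
  using adjoint_op [OF X.hilbert_space_axioms Y.hilbert_space_axioms lin bdd, of x "v i"] dfd
  by (simp add: is_DFD_def X.ip_scaleR_right)

lemma filter_noise_le:
  assumes "i \<in> \<Lambda>" and "0 < \<alpha>"
  shows "\<bar>\<kappa> i * g \<alpha> ((\<kappa> i)\<^sup>2)\<bar> \<le> \<gamma>1 / sqrt \<alpha>"
proof -
  have "ereal \<bar>sqrt ((\<kappa> i)\<^sup>2) * g \<alpha> ((\<kappa> i)\<^sup>2)\<bar> \<le> (SUP \<mu>\<in>half_open_dom a. ereal \<bar>sqrt \<mu> * g \<alpha> \<mu>\<bar>)"
    by (rule SUP_upper [OF half_open_domI [OF kappa_mem [OF assms(1)]]])
  also have "\<dots> \<le> ereal (\<gamma>1 / sqrt \<alpha>)"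
    using qual assms(2) by (simp add: filter_qualification_def)
  finally show ?thesis using kappa_pos [OF assms(1)] by simp
qed

lemma filter_approximation_le:
  assumes "i \<in> \<Lambda>" and "\<alpha> \<in> open_dom a"
  shows "\<bar>1 - (\<kappa> i)\<^sup>2 * g \<alpha> ((\<kappa> i)\<^sup>2)\<bar> \<le> \<gamma>2 * sqrt (\<phi> \<alpha>) * sqrt (inverse (\<phi> ((\<kappa> i)\<^sup>2)))"
proof -
  let ?f = "\<lambda>\<mu>. ereal (\<bar>1 - \<mu> * g \<alpha> \<mu>\<bar> * sqrt (if \<mu> = 0 then 0 else \<phi> \<mu>))"
  have "?f ((\<kappa> i)\<^sup>2) \<le> (SUP \<mu>\<in>half_open_dom a. ?f \<mu>)"
    by (rule SUP_upper [OF half_open_domI [OF kappa_mem [OF assms(1)]]])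
  also have "\<dots> \<le> ereal (\<gamma>2 * sqrt (\<phi> \<alpha>))"
    using qual assms(2) unfolding filter_qualification_def by blast
  finally have "\<bar>1 - (\<kappa> i)\<^sup>2 * g \<alpha> ((\<kappa> i)\<^sup>2)\<bar> * sqrt (\<phi> ((\<kappa> i)\<^sup>2)) \<le> \<gamma>2 * sqrt (\<phi> \<alpha>)"
    using kappa_pos [OF assms(1)] by simp
  then show ?thesis
    unfolding real_sqrt_inverse using phi_kappa_pos [OF assms(1)] by (simp add: field_simps)
qed

text \<open>
  The coefficients of the error in the dual frame split into propagated noise, controlled by the
  upper frame bound of \<open>v\<close>, and approximation error, controlled by the source condition.  The lower
  frame bound of \<open>u\<close> bounds the synthesis of these coefficients.
\<close>

lemma error_bound:
  assumes x: "x \<in> M" "x \<in> HX" and \<alpha>: "\<alpha> \<in> open_dom a"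
    and yd: "\<And>i. i \<in> \<Lambda> \<Longrightarrow> ipY yd (v i) = ipY (K x) (v i) + ipY d (v i)" and d: "norm d \<le> \<delta>"
  shows "norm (R \<alpha> yd - x)
    \<le> sqrt (inverse A\<^sub>u) * (\<gamma>1 / sqrt \<alpha> * (sqrt B\<^sub>v * \<delta>) + \<gamma>2 * sqrt (\<phi> \<alpha>) * E)"
proof -
  define p where "p = \<gamma>1 / sqrt \<alpha>"
  define q where "q = \<gamma>2 * sqrt (\<phi> \<alpha>)"
  define D where "D = p * (sqrt B\<^sub>v * \<delta>) + q * E"
  define h where "h i = \<kappa> i * g \<alpha> ((\<kappa> i)\<^sup>2)" for i
  define c where "c i = of_real (h i) * ipY yd (v i) - ipX x (u i)" for i
  have \<alpha>0: "0 < \<alpha>" using \<alpha> by (simp add: open_dom_def)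
  have pq: "0 \<le> p" "0 \<le> q"
    using gamma_pos \<alpha>0 phi_pos [OF \<alpha>] by (auto simp: p_def q_def)
  have \<delta>: "0 \<le> \<delta>" using d norm_ge_zero order.trans by blast
  have D: "0 \<le> D" using pq \<delta> V.B_pos E_pos by (simp add: D_def)
  let ?N = "\<lambda>i. norm (ipY d (v i))"
  let ?T = "\<lambda>i. sqrt (inverse (\<phi> ((\<kappa> i)\<^sup>2))) * norm (ipX x (u i))"
  have c_le: "norm (c i) \<le> p * ?N i + q * ?T i" if i: "i \<in> \<Lambda>" for i
  proof -
    have "c i = of_real (h i) * ipY d (v i) + (of_real (h i * \<kappa> i) - 1) * ipX x (u i)"
      unfolding c_def yd [OF i] diagonalization [OF i] by (simp add: algebra_simps)
    also have "\<dots> = of_real (h i) * ipY d (v i) - of_real (1 - (\<kappa> i)\<^sup>2 * g \<alpha> ((\<kappa> i)\<^sup>2)) * ipX x (u i)"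
      by (simp add: h_def power2_eq_square algebra_simps)
    finally have "norm (c i) \<le> \<bar>h i\<bar> * ?N i + \<bar>1 - (\<kappa> i)\<^sup>2 * g \<alpha> ((\<kappa> i)\<^sup>2)\<bar> * norm (ipX x (u i))"
      using norm_triangle_ineq4 by (metis norm_mult norm_of_real)
    also have "\<dots> \<le> p * ?N i + (q * sqrt (inverse (\<phi> ((\<kappa> i)\<^sup>2)))) * norm (ipX x (u i))"
      unfolding p_def q_def h_def
      by (intro add_mono mult_right_mono filter_noise_le filter_approximation_le i \<alpha> \<alpha>0) auto
    finally show ?thesis by (simp add: mult.assoc)
  qed
  have bound: "(\<Sum>i\<in>F. (norm (c i))\<^sup>2) \<le> D\<^sup>2" if F: "finite F" "F \<subseteq> \<Lambda>" for F
  proof -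
    have "(\<Sum>i\<in>F. (?N i)\<^sup>2) \<le> B\<^sub>v * (norm d)\<^sup>2" by (rule V.bessel_finite [OF F])
    also have "\<dots> \<le> B\<^sub>v * \<delta>\<^sup>2"
      using V.B_pos d by (intro mult_left_mono power_mono) auto
    finally have "L2_set ?N F \<le> sqrt (B\<^sub>v * \<delta>\<^sup>2)"
      unfolding L2_set_def by (rule real_sqrt_le_mono)
    then have N: "L2_set ?N F \<le> sqrt B\<^sub>v * \<delta>" using \<delta> by (simp add: real_sqrt_mult)
    have T2: "(?T i)\<^sup>2 = inverse (\<phi> ((\<kappa> i)\<^sup>2)) * (norm (ipX x (u i)))\<^sup>2" if "i \<in> \<Lambda>" for i
      using phi_kappa_pos [OF that] by (simp add: power_mult_distrib)
    have "(\<Sum>i\<in>F. (?T i)\<^sup>2) = (\<Sum>i\<in>F. inverse (\<phi> ((\<kappa> i)\<^sup>2)) * (norm (ipX x (u i)))\<^sup>2)"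
      using F T2 by (intro sum.cong) auto
    also have "\<dots> \<le> (\<Sum>\<^sub>\<infinity>i\<in>\<Lambda>. inverse (\<phi> ((\<kappa> i)\<^sup>2)) * (norm (ipX x (u i)))\<^sup>2)"
      by (rule finite_sum_le_infsum [OF _ F])
        (use x(1) phi_kappa_pos in \<open>auto simp: source_set_def less_imp_le\<close>)
    also have "\<dots> \<le> E\<^sup>2" using x(1) by (simp add: source_set_def)
    finally have "L2_set ?T F \<le> sqrt (E\<^sup>2)"
      unfolding L2_set_def by (rule real_sqrt_le_mono)
    then have T: "L2_set ?T F \<le> E" using E_pos by simp
    have "L2_set (\<lambda>i. norm (c i)) F \<le> L2_set (\<lambda>i. p * ?N i + q * ?T i) F"
      using c_le F by (intro L2_set_mono) auto
    also have "\<dots> \<le> L2_set (\<lambda>i. p * ?N i) F + L2_set (\<lambda>i. q * ?T i) F"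
      by (rule L2_set_triangle_ineq)
    also have "\<dots> = p * L2_set ?N F + q * L2_set ?T F"
      using pq by (simp only: L2_set_right_distrib)
    also have "\<dots> \<le> D"
      unfolding D_def by (intro add_mono mult_left_mono N T pq)
    finally have "(L2_set (\<lambda>i. norm (c i)) F)\<^sup>2 \<le> D\<^sup>2"
      by (rule power_mono) simp
    then show ?thesis by (simp add: L2_set_def sum_nonneg)
  qed
  have "((\<lambda>i. scX (c i) (U.dual i) + scX (ipX x (u i)) (U.dual i)) has_sum
      (\<Sum>\<^sub>\<infinity>i\<in>\<Lambda>. scX (c i) (U.dual i)) + x) \<Lambda>"
    by (intro has_sum_add has_sum_infsum U.dual_series(1) [OF D bound] U.dual_reconstruction x(2))
  then have "R \<alpha> yd = (\<Sum>\<^sub>\<infinity>i\<in>\<Lambda>. scX (c i) (U.dual i)) + x"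
    unfolding filtered_DFD_def
    by (intro infsumI) (simp add: c_def h_def flip: X.scale_left_distrib)
  then have "norm (R \<alpha> yd - x) \<le> sqrt (inverse A\<^sub>u) * D"
    using U.dual_series(2) [OF D bound] by simp
  then show ?thesis by (simp only: D_def p_def q_def)
qed

text \<open>
  The parameter \<open>\<mu>\<close> with \<open>\<mu> \<phi>(\<mu>) = A\<^sub>v \<delta>\<^sup>2 / E\<^sup>2\<close> balances the two contributions: both are
  multiples of \<open>E \<surd>\<phi>(\<mu>)\<close>.
\<close>

lemma balanced_error_bound:
  assumes x: "x \<in> M" "x \<in> HX" and \<mu>: "\<mu> \<in> open_dom a" "\<phi> \<mu> * \<mu> = A\<^sub>v * \<delta>\<^sup>2 / E\<^sup>2"
    and yd: "\<And>i. i \<in> \<Lambda> \<Longrightarrow> ipY yd (v i) = ipY (K x) (v i) + ipY d (v i)" and d: "norm d \<le> \<delta>"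
  shows "norm (R \<mu> yd - x) \<le> rate_const * sqrt (\<phi> \<mu>)"
proof -
  have \<delta>: "0 \<le> \<delta>" using d norm_ge_zero order.trans by blast
  have \<mu>0: "0 < \<mu>" using \<mu>(1) by (simp add: open_dom_def)
  have "\<delta>\<^sup>2 = inverse A\<^sub>v * E\<^sup>2 * (\<phi> \<mu> * \<mu>)"
    unfolding \<mu>(2) using Av_pos E_pos by simp
  then have "sqrt (\<delta>\<^sup>2) = sqrt (inverse A\<^sub>v * E\<^sup>2 * (\<phi> \<mu> * \<mu>))" by (rule arg_cong)
  then have "\<delta> = sqrt (inverse A\<^sub>v) * E * (sqrt (\<phi> \<mu>) * sqrt \<mu>)"
    using \<delta> E_pos by (simp add: real_sqrt_mult)
  then have 1: "\<gamma>1 / sqrt \<mu> * (sqrt B\<^sub>v * \<delta>) = sqrt (inverse A\<^sub>v) * (\<gamma>1 * sqrt B\<^sub>v) * E * sqrt (\<phi> \<mu>)"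
    using \<mu>0 by (simp add: field_simps)
  have 2: "\<gamma>2 * sqrt (\<phi> \<mu>) * E = sqrt (inverse A\<^sub>v) * (\<gamma>2 * sqrt A\<^sub>v) * E * sqrt (\<phi> \<mu>)"
    using Av_pos by (simp add: real_sqrt_inverse)
  have "norm (R \<mu> yd - x)
    \<le> sqrt (inverse A\<^sub>u) * (\<gamma>1 / sqrt \<mu> * (sqrt B\<^sub>v * \<delta>) + \<gamma>2 * sqrt (\<phi> \<mu>) * E)"
    by (rule error_bound [OF x \<mu>(1) yd d])
  also have "\<dots> = rate_const * sqrt (\<phi> \<mu>)"
    unfolding 1 2 by (simp add: real_sqrt_mult algebra_simps)
  finally show ?thesis .
qed

lemma worst_case_upper_bound:
  assumes "\<mu> \<in> open_dom a" and "\<phi> \<mu> * \<mu> = A\<^sub>v * \<delta>\<^sup>2 / E\<^sup>2"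
  shows "worst_case_error ipX K M \<delta> (R \<mu>) \<le> ennreal (rate_const * sqrt (\<phi> \<mu>))"
proof (rule worst_case_error_le)
  fix x yd assume x: "x \<in> M" "x \<in> HX" "norm (K x - yd) \<le> \<delta>"
  show "norm (R \<mu> yd - x) \<le> rate_const * sqrt (\<phi> \<mu>)"
    by (rule balanced_error_bound [OF x(1,2) assms, of _ "yd - K x"])
      (use x(3) in \<open>auto simp: Y.ip_diff_left norm_minus_commute\<close>)
qed

section \<open>Order optimality\<close>

text \<open>
  For a minimal frame, a multiple of a single dual vector exhausts the source condition while its
  image is only as large as the noise level belonging to its index.
\<close>

lemma extremal_element:
  assumes min: "minimal_family scX \<Lambda> u" and j: "j \<in> \<Lambda>"
  obtains x where "x \<in> M" "- x \<in> M" "x \<in> HX" "- x \<in> HX" "K x \<noteq> 0"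
    "E * sqrt (\<phi> ((\<kappa> j)\<^sup>2)) \<le> sqrt B\<^sub>u * norm x"
    "vinf * norm (K x) \<le> E * sqrt ((\<kappa> j)\<^sup>2 * \<phi> ((\<kappa> j)\<^sup>2))"
proof -
  define r where "r = E * sqrt (\<phi> ((\<kappa> j)\<^sup>2))"
  define x where "x = r *\<^sub>R U.dual j"
  have r: "0 < r" using E_pos phi_kappa_pos [OF j] by (simp add: r_def)
  have ipx: "ipX x (u i) = (if i = j then of_real r else 0)" if "i \<in> \<Lambda>" for i
    using U.minimal_imp_biorthogonal [OF min that j] by (simp add: x_def X.ip_scaleR_left)
  have supp: "((\<lambda>i. b i * (norm (ipX x (u i)))\<^sup>2) has_sum (b j * r\<^sup>2)) \<Lambda>" for b :: "'i \<Rightarrow> real"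
    by (rule has_sum_finite_neutralI [of "{j}"]) (use j r ipx in auto)
  have xH: "x \<in> HX"
    unfolding x_def X.smul_of_real [symmetric]
    by (intro X.subspace_scale U.subspace_H U.dual_mem j)
  have "inverse (\<phi> ((\<kappa> j)\<^sup>2)) * r\<^sup>2 = E\<^sup>2"
    using phi_kappa_pos [OF j] by (simp add: r_def power_mult_distrib)
  with supp [of "\<lambda>i. inverse (\<phi> ((\<kappa> i)\<^sup>2))"]
  have xM: "x \<in> M" by (auto simp: source_set_def has_sum_iff)
  have "U.frame_energy x = r\<^sup>2" using supp [of "\<lambda>_. 1"] by (simp add: has_sum_iff)
  then have "r\<^sup>2 \<le> B\<^sub>u * (norm x)\<^sup>2" using U.bessel [of x] by simp
  then have "sqrt (r\<^sup>2) \<le> sqrt (B\<^sub>u * (norm x)\<^sup>2)" by (rule real_sqrt_le_mono)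
  then have nx: "r \<le> sqrt B\<^sub>u * norm x" using r by (simp add: real_sqrt_mult)
  have KxH: "K x \<in> HY" by (rule subsetD [OF closure_subset rangeI])
  have "(\<Sum>\<^sub>\<infinity>i\<in>\<Lambda>. (norm (ipY (K x) (v i)))\<^sup>2) = (\<Sum>\<^sub>\<infinity>i\<in>\<Lambda>. (\<kappa> i)\<^sup>2 * (norm (ipX x (u i)))\<^sup>2)"
    by (intro infsum_cong) (simp add: diagonalization norm_mult power_mult_distrib)
  also have "\<dots> = (\<kappa> j)\<^sup>2 * r\<^sup>2" using supp [of "\<lambda>i. (\<kappa> i)\<^sup>2"] by (simp add: has_sum_iff)
  finally have "vinf * norm (K x) \<le> sqrt ((\<kappa> j)\<^sup>2 * r\<^sup>2)"
    using V.frame_inf_le [OF KxH] by simp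
  also have "\<dots> = E * sqrt ((\<kappa> j)\<^sup>2 * \<phi> ((\<kappa> j)\<^sup>2))"
    using r E_pos by (simp add: real_sqrt_mult) (simp add: r_def)
  finally have nKx: "vinf * norm (K x) \<le> E * sqrt ((\<kappa> j)\<^sup>2 * \<phi> ((\<kappa> j)\<^sup>2))" .
  have "ipY (K x) (v j) \<noteq> 0"
    using diagonalization [OF j] ipx [OF j] r kappa_pos [OF j] by simp
  then have "K x \<noteq> 0" by auto
  then show ?thesis
    using that [of x] xM xH nx nKx X.subspace_neg [OF U.subspace_H xH]
    by (auto simp: r_def source_set_def X.ip_minus_left)
qed

text \<open>
  Without an index and minimality, \<open>K\<close> could vanish, and then the infimum over the empty unit sphere
  has no definite sign.
\<close>

lemma vinf_pos:
  assumes "minimal_family scX \<Lambda> u" and "j \<in> \<Lambda>"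
  shows "0 < vinf"
proof (rule extremal_element [OF assms])
  fix x assume "K x \<noteq> 0"
  moreover have "K x \<in> HY" by (rule subsetD [OF closure_subset rangeI])
  ultimately have "0 \<le> vinf" by (intro V.frame_inf_nonneg [of "K x"])
  moreover have "vinf \<noteq> 0" using Av_pos Av_less by auto
  ultimately show ?thesis by simp
qed

abbreviation \<delta>star :: "'i \<Rightarrow> real" where
  "\<delta>star i \<equiv> delta_star vinf E \<phi> (\<kappa> i)"

lemma worst_case_lower_bound:
  assumes min: "minimal_family scX \<Lambda> u" and j: "j \<in> \<Lambda>" and \<delta>: "\<delta>star j \<le> \<delta>"
  shows "ennreal (E * sqrt (\<phi> ((\<kappa> j)\<^sup>2)) / sqrt B\<^sub>u) \<le> worst_case_error ipX K M \<delta> R'"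
proof -
  obtain x where x: "x \<in> M" "- x \<in> M" "x \<in> HX" "- x \<in> HX" "K x \<noteq> 0"
    "E * sqrt (\<phi> ((\<kappa> j)\<^sup>2)) \<le> sqrt B\<^sub>u * norm x"
    "vinf * norm (K x) \<le> E * sqrt ((\<kappa> j)\<^sup>2 * \<phi> ((\<kappa> j)\<^sup>2))"
    by (rule extremal_element [OF min j])
  have "norm (K x) \<le> \<delta>star j"
    using x(7) vinf_pos [OF min j] by (simp add: delta_star_def field_simps)
  then have "norm (K x) \<le> \<delta>" using \<delta> by simp
  then have "ennreal (norm x) \<le> worst_case_error ipX K M \<delta> R'"
    using x(1-4) by (intro norm_le_worst_case_error) (auto simp: K.neg)
  moreover have "E * sqrt (\<phi> ((\<kappa> j)\<^sup>2)) / sqrt B\<^sub>u \<le> norm x"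
    using x(6) U.B_pos by (simp add: field_simps)
  ultimately show ?thesis by (metis ennreal_leI order.trans)
qed

lemma \<delta>star_square:
  assumes "minimal_family scX \<Lambda> u" and "j \<in> \<Lambda>"
  shows "vinf\<^sup>2 * (\<delta>star j)\<^sup>2 / E\<^sup>2 = \<phi> ((\<kappa> j)\<^sup>2) * (\<kappa> j)\<^sup>2"
  using vinf_pos [OF assms] E_pos kappa_pos [OF assms(2)] phi_kappa_pos [OF assms(2)]
  by (simp add: delta_star_def power_mult_distrib field_simps)

lemma \<delta>star_pos:
  assumes "minimal_family scX \<Lambda> u" and "j \<in> \<Lambda>"
  shows "0 < \<delta>star j"
  using vinf_pos [OF assms] E_pos kappa_pos [OF assms(2)] phi_kappa_pos [OF assms(2)]
  by (simp add: delta_star_def)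

lemma optimality_const_pos: "0 < \<beta> \<Longrightarrow> 0 < rate_const * sqrt B\<^sub>u / (E * \<beta>)"
  by (rule divide_pos_pos [OF mult_pos_pos [OF rate_const_pos]]) (use U.B_pos E_pos in simp_all)

text \<open>
  If \<open>\<delta>\<close> exceeds the noise level of the index \<open>j\<close> by a factor of at most \<open>1 / \<beta>\<close>, then \<open>\<mu> \<phi>(\<mu>)\<close> exceeds
  its value at \<open>\<kappa>\<^sub>j\<^sup>2\<close> by a factor of at most \<open>1 / \<beta>\<^sup>2\<close>.  Since \<open>\<mu> \<ge> \<kappa>\<^sub>j\<^sup>2\<close>, the same is true of \<open>\<phi>(\<mu>)\<close>
  alone, and upper and lower bound are comparable.
\<close>

lemma order_optimal_at:
  assumes min: "minimal_family scX \<Lambda> u" and j: "j \<in> \<Lambda>" and \<beta>: "0 < \<beta>"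
    and \<delta>: "\<delta>star j \<le> \<delta>" "\<delta> \<le> inverse \<beta> * \<delta>star j"
    and \<mu>: "\<mu> \<in> open_dom a" "\<phi> \<mu> * \<mu> = vinf\<^sup>2 * \<delta>\<^sup>2 / E\<^sup>2"
  shows "worst_case_error ipX K M \<delta> (R (parameter_choice a \<phi> A\<^sub>v E \<delta>))
    \<le> ennreal (rate_const * sqrt B\<^sub>u / (E * \<beta>)) * (INF R'. worst_case_error ipX K M \<delta> R')"
proof -
  have \<delta>0: "0 < \<delta>" using \<delta>(1) \<delta>star_pos [OF min j] by simp
  define k where "k = (\<kappa> j)\<^sup>2"
  have k: "k \<in> open_dom a" "0 < k" "0 < \<phi> k"
    using kappa_mem [OF j] kappa_pos [OF j] phi_kappa_pos [OF j] by (auto simp: k_def)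
  have \<mu>0: "0 < \<mu>" using \<mu>(1) by (simp add: open_dom_def)
  have scale: "vinf\<^sup>2 * s\<^sup>2 / E\<^sup>2 \<le> vinf\<^sup>2 * t\<^sup>2 / E\<^sup>2" if "0 \<le> s" "s \<le> t" for s t
    using that by (intro divide_right_mono mult_left_mono power_mono) auto
  have "\<phi> k * k \<le> \<phi> \<mu> * \<mu>"
    using scale [OF less_imp_le [OF \<delta>star_pos [OF min j]] \<delta>(1)]
    by (simp add: \<delta>star_square [OF min j] \<mu>(2) k_def)
  have "k \<le> \<mu>"
  proof (rule ccontr)
    assume "\<not> k \<le> \<mu>"
    then have "\<phi> \<mu> * \<mu> < \<phi> k * k"
      using phi_less [OF \<mu>(1) k(1)] phi_pos [OF \<mu>(1)] \<mu>0 by (intro mult_strict_mono) auto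
    with \<open>\<phi> k * k \<le> \<phi> \<mu> * \<mu>\<close> show False by simp
  qed
  have "\<phi> \<mu> * \<mu> \<le> vinf\<^sup>2 * (inverse \<beta> * \<delta>star j)\<^sup>2 / E\<^sup>2"
    using scale [OF less_imp_le [OF \<delta>0] \<delta>(2)] \<mu>(2) by simp
  also have "\<dots> = (inverse \<beta>)\<^sup>2 * (vinf\<^sup>2 * (\<delta>star j)\<^sup>2 / E\<^sup>2)"
    by (simp add: power_mult_distrib)
  also have "\<dots> = (inverse \<beta>)\<^sup>2 * \<phi> k * k"
    unfolding \<delta>star_square [OF min j] by (simp add: k_def)
  also have "\<dots> \<le> (inverse \<beta>)\<^sup>2 * \<phi> k * \<mu>"
    using \<open>k \<le> \<mu>\<close> k by (intro mult_left_mono) auto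
  finally have "\<phi> \<mu> \<le> (inverse \<beta>)\<^sup>2 * \<phi> k" using \<mu>0 by simp
  then have "sqrt (\<phi> \<mu>) \<le> sqrt ((inverse \<beta>)\<^sup>2 * \<phi> k)" by (rule real_sqrt_le_mono)
  then have \<phi>\<mu>: "sqrt (\<phi> \<mu>) \<le> inverse \<beta> * sqrt (\<phi> k)"
    using \<beta> by (simp add: real_sqrt_mult)
  have "A\<^sub>v * \<delta>\<^sup>2 / E\<^sup>2 < \<phi> \<mu> * \<mu>"
    unfolding \<mu>(2) using Av_less \<delta>0 E_pos by (intro divide_strict_right_mono mult_strict_right_mono) auto
  moreover have "0 < A\<^sub>v * \<delta>\<^sup>2 / E\<^sup>2" using Av_pos \<delta>0 E_pos by simp
  ultimately obtain \<nu> where \<nu>: "\<nu> \<in> open_dom a" "\<phi> \<nu> * \<nu> = A\<^sub>v * \<delta>\<^sup>2 / E\<^sup>2" "\<nu> < \<mu>"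
    using phi_times_id_attains [OF \<mu>(1)] by blast
  have choice: "parameter_choice a \<phi> A\<^sub>v E \<delta> = \<nu>"
    unfolding parameter_choice_def \<nu>(2) [symmetric] Theta_inv_phi [OF \<nu>(1)] phi_inv_phi [OF \<nu>(1)] ..
  have "sqrt (\<phi> \<nu>) \<le> inverse \<beta> * sqrt (\<phi> k)"
    using phi_less [OF \<nu>(1) \<mu>(1) \<nu>(3)] \<phi>\<mu> by (intro order.trans [OF _ \<phi>\<mu>]) simp
  then have "rate_const * sqrt (\<phi> \<nu>) \<le> rate_const * (inverse \<beta> * sqrt (\<phi> k))"
    using rate_const_pos by (intro mult_left_mono) auto
  also have "\<dots> = (rate_const * sqrt B\<^sub>u / (E * \<beta>)) * (E * sqrt (\<phi> k) / sqrt B\<^sub>u)"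
    using U.B_pos E_pos \<beta> by (simp add: field_simps)
  finally have "worst_case_error ipX K M \<delta> (R \<nu>)
      \<le> ennreal ((rate_const * sqrt B\<^sub>u / (E * \<beta>)) * (E * sqrt (\<phi> k) / sqrt B\<^sub>u))"
    by (rule order.trans [OF worst_case_upper_bound [OF \<nu>(1,2)] ennreal_leI])
  also have "\<dots> = ennreal (rate_const * sqrt B\<^sub>u / (E * \<beta>)) * ennreal (E * sqrt (\<phi> k) / sqrt B\<^sub>u)"
    by (rule ennreal_mult [OF less_imp_le [OF optimality_const_pos [OF \<beta>]]])
      (use U.B_pos E_pos k in simp)
  also have "\<dots> \<le> ennreal (rate_const * sqrt B\<^sub>u / (E * \<beta>)) * (INF R'. worst_case_error ipX K M \<delta> R')"
    using worst_case_lower_bound [OF min j \<delta>(1)] unfolding k_def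
    by (intro mult_left_mono INF_greatest) auto
  finally show ?thesis unfolding choice .
qed

lemma minimal_imp_sequential_order_optimal:
  assumes min: "minimal_family scX \<Lambda> u" and inf: "(INF i\<in>\<Lambda>. ereal (\<kappa> i)) = 0"
  shows "sequential_order_optimal ipX K M (\<lambda>\<delta>. R (parameter_choice a \<phi> A\<^sub>v E \<delta>))"
proof -
  have "\<exists>i\<in>\<Lambda>. \<kappa> i < 1 / real (Suc n)" for n
  proof -
    have "(INF i\<in>\<Lambda>. ereal (\<kappa> i)) < ereal (1 / real (Suc n))" unfolding inf by simp
    then show ?thesis by (auto simp: INF_less_iff)
  qed
  then obtain J where J: "\<And>n. J n \<in> \<Lambda>" "\<And>n. \<kappa> (J n) < 1 / real (Suc n)" by metis
  have "(\<lambda>n. \<kappa> (J n)) \<longlonglongrightarrow> 0"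
  proof (rule tendsto_sandwich [where f = "\<lambda>_. 0" and h = "\<lambda>n. 1 / real (Suc n)"])
    show "(\<lambda>n. 1 / real (Suc n)) \<longlonglongrightarrow> 0" by (rule LIMSEQ_Suc [OF lim_1_over_n])
    show "(\<lambda>_::nat. 0::real) \<longlonglongrightarrow> 0" by (rule tendsto_const)
    show "\<forall>\<^sub>F n in sequentially. 0 \<le> \<kappa> (J n)"
      by (intro always_eventually allI less_imp_le kappa_pos J)
    show "\<forall>\<^sub>F n in sequentially. \<kappa> (J n) \<le> 1 / real (Suc n)"
      by (intro always_eventually allI less_imp_le J)
  qed
  then have sq: "(\<lambda>n. (\<kappa> (J n))\<^sup>2) \<longlonglongrightarrow> 0"
    using tendsto_power [of _ 0 _ 2] by fastforce
  have "\<kappa> (J n) \<noteq> 0" for n using kappa_pos [OF J(1)] by (metis less_irrefl)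
  then have "filterlim (\<lambda>n. (\<kappa> (J n))\<^sup>2) (at_right 0) sequentially"
    unfolding filterlim_at
    using sq by (auto intro!: always_eventually)
  then have "(\<lambda>n. \<phi> ((\<kappa> (J n))\<^sup>2)) \<longlonglongrightarrow> 0"
    by (rule filterlim_compose [OF phi_tendsto])
  then have "(\<lambda>n. inverse vinf * E * sqrt ((\<kappa> (J n))\<^sup>2 * \<phi> ((\<kappa> (J n))\<^sup>2))) \<longlonglongrightarrow> inverse vinf * E * sqrt (0 * 0)"
    by (intro tendsto_intros sq)
  then have lim: "(\<lambda>n. \<delta>star (J n)) \<longlonglongrightarrow> 0" by (simp add: delta_star_def)
  have "0 < rate_const * sqrt B\<^sub>u / (E * 1)" by (rule optimality_const_pos) simp
  moreover have "worst_case_error ipX K M (\<delta>star (J n)) (R (parameter_choice a \<phi> A\<^sub>v E (\<delta>star (J n))))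
      \<le> ennreal (rate_const * sqrt B\<^sub>u / (E * 1)) * (INF R'. worst_case_error ipX K M (\<delta>star (J n)) R')" for n
    by (rule order_optimal_at [OF min J(1) _ _ _ kappa_mem [OF J(1)] \<delta>star_square [OF min J(1), symmetric]]) auto
  ultimately show ?thesis
    unfolding sequential_order_optimal_def
    by (intro exI [of _ "\<lambda>n. \<delta>star (J n)"] exI [of _ "rate_const * sqrt B\<^sub>u / (E * 1)"] conjI allI
        lim \<delta>star_pos [OF min J(1)])
qed

lemma minimal_imp_uniform_order_optimal:
  assumes min: "minimal_family scX \<Lambda> u" and \<beta>: "0 < \<beta>" and \<delta>0: "0 < \<delta>0"
    and cover: "{0<..\<delta>0} \<subseteq> (\<Union>i\<in>\<Lambda>. {\<delta>star i .. inverse \<beta> * \<delta>star i})"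
  shows "uniform_order_optimal ipX K M (\<lambda>\<delta>. R (parameter_choice a \<phi> A\<^sub>v E \<delta>))"
proof -
  obtain j where j: "j \<in> \<Lambda>" using cover \<delta>0 by fastforce
  \<comment> \<open>Below the noise level of the index \<open>j\<close>, the point \<open>|v|\<^sub>i\<^sub>n\<^sub>f\<^sup>2 \<delta>\<^sup>2 / E\<^sup>2\<close> is a value of \<open>\<mu> \<phi>(\<mu>)\<close>.\<close>
  have opt: "worst_case_error ipX K M \<delta> (R (parameter_choice a \<phi> A\<^sub>v E \<delta>))
      \<le> ennreal (rate_const * sqrt B\<^sub>u / (E * \<beta>)) * (INF R'. worst_case_error ipX K M \<delta> R')"
    if \<delta>: "0 < \<delta>" "\<delta> < min \<delta>0 (\<delta>star j)" for \<delta>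
  proof -
    obtain i where i: "i \<in> \<Lambda>" "\<delta>star i \<le> \<delta>" "\<delta> \<le> inverse \<beta> * \<delta>star i"
      using cover \<delta> by fastforce
    have "vinf\<^sup>2 * \<delta>\<^sup>2 / E\<^sup>2 < vinf\<^sup>2 * (\<delta>star j)\<^sup>2 / E\<^sup>2"
      using \<delta> vinf_pos [OF min j] E_pos
      by (intro divide_strict_right_mono mult_strict_left_mono power_strict_mono) auto
    then have "vinf\<^sup>2 * \<delta>\<^sup>2 / E\<^sup>2 < \<phi> ((\<kappa> j)\<^sup>2) * (\<kappa> j)\<^sup>2"
      unfolding \<delta>star_square [OF min j] .
    moreover have "0 < vinf\<^sup>2 * \<delta>\<^sup>2 / E\<^sup>2" using \<delta>(1) vinf_pos [OF min j] E_pos by simp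
    ultimately obtain \<mu> where "\<mu> \<in> open_dom a" "\<phi> \<mu> * \<mu> = vinf\<^sup>2 * \<delta>\<^sup>2 / E\<^sup>2"
      using phi_times_id_attains [OF kappa_mem [OF j]] by blast
    then show ?thesis by (rule order_optimal_at [OF min i(1) \<beta> i(2,3)])
  qed
  have "0 < min \<delta>0 (\<delta>star j)" using \<delta>0 \<delta>star_pos [OF min j] by simp
  moreover have "0 < rate_const * sqrt B\<^sub>u / (E * \<beta>)" by (rule optimality_const_pos [OF \<beta>])
  ultimately show ?thesis
    unfolding uniform_order_optimal_def using opt by blast
qed

end

theorem theorem3p4:
  fixes scX :: "'k::rc_field \<Rightarrow> 'x::banach \<Rightarrow> 'x" and ipX :: "'x \<Rightarrow> 'x \<Rightarrow> 'k"
    and scY :: "'k \<Rightarrow> 'y::banach \<Rightarrow> 'y" and ipY :: "'y \<Rightarrow> 'y \<Rightarrow> 'k"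
    and K :: "'x \<Rightarrow> 'y"
    and \<Lambda> :: "'i set" and u :: "'i \<Rightarrow> 'x" and v :: "'i \<Rightarrow> 'y" and \<kappa> :: "'i \<Rightarrow> real"
    and a :: ereal and \<phi> :: "real \<Rightarrow> real" and g :: "real \<Rightarrow> real \<Rightarrow> real"
    and \<gamma>1 \<gamma>2 E A\<^sub>v A\<^sub>u B\<^sub>v vinf :: real and R :: "real \<Rightarrow> 'y \<Rightarrow> 'x" and M :: "'x set"
    and \<alpha> :: "real \<Rightarrow> real"
  defines "R \<equiv> filtered_DFD scX ipX ipY K \<Lambda> u v \<kappa> g"
    and "M \<equiv> source_set ipX \<Lambda> u \<kappa> \<phi> E"
    and "\<alpha> \<equiv> parameter_choice a \<phi> A\<^sub>v E"
    and "vinf \<equiv> frame_inf ipY \<Lambda> v (closure (range K))"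
  assumes "hilbert_space scX ipX" and "hilbert_space scY ipY"
    and "Vector_Spaces.linear scX scY K" and "bounded_linear K"
    and "countable \<Lambda>"
    and "is_DFD ipX ipY K \<Lambda> u v \<kappa>"
    and "endpoint_cond \<Lambda> \<kappa> a"
    and "index_function a \<phi>"
    and "regularizing_filter a g"
    and "filter_qualification a \<phi> g \<gamma>1 \<gamma>2"
    and "0 < E"
    and "0 < A\<^sub>v" and "A\<^sub>v < vinf\<^sup>2"
    and "lower_frame_bound ipX \<Lambda> u (orth_compl ipX (ker K)) A\<^sub>u"
    and "upper_frame_bound ipY \<Lambda> v (closure (range K)) B\<^sub>v"
  shows "(\<forall>\<delta>>0.
            A\<^sub>v * \<delta>\<^sup>2 / E\<^sup>2 \<in> Theta a \<phi> ` Theta_dom a \<phi> \<longrightarrow>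
            vinf\<^sup>2 * \<delta>\<^sup>2 / E\<^sup>2 \<in> Theta a \<phi> ` Theta_dom a \<phi> \<longrightarrow>
            (\<forall>x y yd. x \<in> M \<and> moore_penrose_solution K y x \<and> norm (yd - y) \<le> \<delta> \<longrightarrow>
               norm (R (\<alpha> \<delta>) yd - x)
                 \<le> sqrt (inverse A\<^sub>u * inverse A\<^sub>v) * (\<gamma>1 * sqrt B\<^sub>v + \<gamma>2 * sqrt A\<^sub>v) * E
                   * sqrt (Theta_inv a \<phi> (vinf\<^sup>2 * \<delta>\<^sup>2 / E\<^sup>2))) \<and>
            worst_case_error ipX K M \<delta> (R (\<alpha> \<delta>))
              \<le> ennreal (sqrt (inverse A\<^sub>u * inverse A\<^sub>v) * (\<gamma>1 * sqrt B\<^sub>v + \<gamma>2 * sqrt A\<^sub>v) * E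
                   * sqrt (Theta_inv a \<phi> (vinf\<^sup>2 * \<delta>\<^sup>2 / E\<^sup>2)))) \<and>
         (minimal_family scX \<Lambda> u \<and> (INF i\<in>\<Lambda>. ereal (\<kappa> i)) = 0 \<longrightarrow>
            sequential_order_optimal ipX K M (\<lambda>\<delta>. R (\<alpha> \<delta>))) \<and>
         (\<forall>\<beta> \<delta>0. 0 < \<beta> \<and> \<beta> < 1 \<and> minimal_family scX \<Lambda> u \<and> 0 < \<delta>0 \<and>
            {0<..\<delta>0} \<subseteq> (\<Union>i\<in>\<Lambda>. {delta_star vinf E \<phi> (\<kappa> i) .. inverse \<beta> * delta_star vinf E \<phi> (\<kappa> i)}) \<longrightarrow>
            uniform_order_optimal ipX K M (\<lambda>\<delta>. R (\<alpha> \<delta>)))"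
proof -
  obtain B\<^sub>u where Bu: "upper_frame_bound ipX \<Lambda> u (orth_compl ipX (ker K)) B\<^sub>u"
    using \<open>is_DFD ipX ipY K \<Lambda> u v \<kappa>\<close> by (auto simp: is_DFD_def is_frame_def)
  interpret D: dfd_regularization scX ipX scY ipY a \<phi> K \<Lambda> u v \<kappa> g \<gamma>1 \<gamma>2 E A\<^sub>u B\<^sub>u A\<^sub>v B\<^sub>v
    by (intro dfd_regularization.intro dfd_regularization_axioms.intro index_fun.intro)
      (fact Bu assms \<open>A\<^sub>v < vinf\<^sup>2\<close> [unfolded vinf_def])+
  let ?C = "sqrt (inverse A\<^sub>u * inverse A\<^sub>v) * (\<gamma>1 * sqrt B\<^sub>v + \<gamma>2 * sqrt A\<^sub>v) * E"
  let ?T = "\<lambda>\<delta>. Theta_inv a \<phi> (vinf\<^sup>2 * \<delta>\<^sup>2 / E\<^sup>2)"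
  have rate: "(\<forall>x y yd. x \<in> M \<and> moore_penrose_solution K y x \<and> norm (yd - y) \<le> \<delta> \<longrightarrow>
        norm (R (\<alpha> \<delta>) yd - x) \<le> ?C * sqrt (?T \<delta>))
      \<and> worst_case_error ipX K M \<delta> (R (\<alpha> \<delta>)) \<le> ennreal (?C * sqrt (?T \<delta>))"
    if \<delta>: "0 < \<delta>" and t1: "A\<^sub>v * \<delta>\<^sup>2 / E\<^sup>2 \<in> Theta a \<phi> ` Theta_dom a \<phi>"
      and t2: "vinf\<^sup>2 * \<delta>\<^sup>2 / E\<^sup>2 \<in> Theta a \<phi> ` Theta_dom a \<phi>" for \<delta>
  proof -
    have "A\<^sub>v * \<delta>\<^sup>2 / E\<^sup>2 < vinf\<^sup>2 * \<delta>\<^sup>2 / E\<^sup>2"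
      using \<delta> \<open>A\<^sub>v < vinf\<^sup>2\<close> \<open>0 < E\<close> by (intro divide_strict_right_mono mult_strict_right_mono) auto
    from D.Theta_range_below [OF t1 t2 this] obtain \<mu>
      where \<mu>: "\<mu> \<in> open_dom a" "\<phi> \<mu> * \<mu> = A\<^sub>v * \<delta>\<^sup>2 / E\<^sup>2" "\<phi> \<mu> \<le> ?T \<delta>"
        and inv: "phi_inv a \<phi> (Theta_inv a \<phi> (A\<^sub>v * \<delta>\<^sup>2 / E\<^sup>2)) = \<mu>"
      by metis
    have \<alpha>: "\<alpha> \<delta> = \<mu>" by (simp add: \<alpha>_def parameter_choice_def inv)
    have C: "?C * sqrt (\<phi> \<mu>) \<le> ?C * sqrt (?T \<delta>)"
      using \<mu>(3) D.rate_const_pos by (intro mult_left_mono) auto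
    have "norm (R \<mu> yd - x) \<le> ?C * sqrt (\<phi> \<mu>)"
      if "x \<in> M" "moore_penrose_solution K y x" "norm (yd - y) \<le> \<delta>" for x y yd
    proof -
      note mp = moore_penrose_orthogonal [OF \<open>hilbert_space scX ipX\<close> \<open>hilbert_space scY ipY\<close>
          \<open>Vector_Spaces.linear scX scY K\<close> that(2)]
      have "ipY yd (v i) = ipY (K x) (v i) + ipY (yd - y) (v i)" if "i \<in> \<Lambda>" for i
        using mp(2) [OF D.V.w_mem [OF that]] by (simp add: D.Y.ip_diff_left)
      then show ?thesis
        using D.balanced_error_bound [OF _ mp(1) \<mu>(1,2) _ that(3)] that(1)
        by (simp only: R_def M_def)
    qed
    moreover have "worst_case_error ipX K M \<delta> (R \<mu>) \<le> ennreal (?C * sqrt (\<phi> \<mu>))"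
      unfolding M_def R_def by (rule D.worst_case_upper_bound [OF \<mu>(1,2)])
    ultimately show ?thesis
      unfolding \<alpha> using C ennreal_leI [OF C] by (meson order.trans)
  qed
  have seq: "sequential_order_optimal ipX K M (\<lambda>\<delta>. R (\<alpha> \<delta>))"
    if "minimal_family scX \<Lambda> u" "(INF i\<in>\<Lambda>. ereal (\<kappa> i)) = 0"
    unfolding M_def R_def \<alpha>_def by (rule D.minimal_imp_sequential_order_optimal [OF that])
  have uni: "uniform_order_optimal ipX K M (\<lambda>\<delta>. R (\<alpha> \<delta>))"
    if "0 < \<beta>" "minimal_family scX \<Lambda> u" "0 < \<delta>0"
      "{0<..\<delta>0} \<subseteq> (\<Union>i\<in>\<Lambda>. {delta_star vinf E \<phi> (\<kappa> i) .. inverse \<beta> * delta_star vinf E \<phi> (\<kappa> i)})"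
    for \<beta> \<delta>0
    unfolding M_def R_def \<alpha>_def
    by (rule D.minimal_imp_uniform_order_optimal [OF that(2,1,3) that(4) [unfolded vinf_def]])
  show ?thesis using rate seq uni by blast
qed

end
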